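(* Suppose the input function $f\colon\mathbb{R}^n\to\mathbb{R}$ is guaranteed to be continuous. Then there exists a one-sided error distribution-free tester for linearity that makes $O\left(\frac{1}{\varepsilon}\log\frac{1}{\varepsilon}\right)$ queries.
   Context: A function $f\colon\mathbb{R}^n\to\mathbb{R}$ is additive if $f(x+y)=f(x)+f(y)$ for all $x,y$, homogeneous if $f(cx)=cf(x)$ for all $x\in\mathbb{R}^n$, $c\in\mathbb{R}$, and linear if it is both additive and homogeneous. For a distribution $\mathcal{D}$ on $\mathbb{R}^n$ and $\varepsilon>0$, a measurable $f$ is $\varepsilon$-far from a property $P$ with respect to $\mathcal{D}$ if $\Pr_{x\sim\mathcal{D}}[f(x)\neq g(x)]>\varepsilon$ for every measurable $g$ satisfying $P$. A distribution-free tester for $P$ is a randomized algorithm given query access to $f$, sampling access to an unknown distribution $\mathcal{D}$ over $\mathbb{R}^n$ and to the standard Gaussian $\mathcal{N}(0,I)$, and $\varepsilon>0$; it must accept with probability at least $2/3$ when $f$ satisfies $P$ and reject with probability at least $2/3$ when $f$ is $\varepsilon$-far from $P$ with respect to $\mathcal{D}$. One-sided error means functions satisfying $P$ are accepted with probability $1$. *)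

theory Defs
  imports "HOL-Probability.Probability" "HOL-Library.Landau_Symbols"
begin

text \<open>
  The dimension is a natural number and not a type, because the constant hidden in the
  query bound must not depend on it. A point of \<open>\<real>\<^sup>n\<close> is an extensional function on
  \<open>{..<n}\<close>; a function on \<open>\<real>\<^sup>n\<close> is given by an Isabelle function of which only the
  values on \<open>space (Rn n)\<close> matter.
\<close>

type_synonym point = "nat \<Rightarrow> real"

definition Rn :: "nat \<Rightarrow> point measure" where
  "Rn n = (\<Pi>\<^sub>M i\<in>{..<n}. borel)"

definition gaussian :: "nat \<Rightarrow> point measure" where
  "gaussian n = (\<Pi>\<^sub>M i\<in>{..<n}. std_normal_distribution)"

definition vadd :: "nat \<Rightarrow> point \<Rightarrow> point \<Rightarrow> point" where
  "vadd n x y = (\<lambda>i\<in>{..<n}. x i + y i)"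

definition vscale :: "nat \<Rightarrow> real \<Rightarrow> point \<Rightarrow> point" where
  "vscale n c x = (\<lambda>i\<in>{..<n}. c * x i)"

definition additive_Rn :: "nat \<Rightarrow> (point \<Rightarrow> real) \<Rightarrow> bool" where
  "additive_Rn n f \<longleftrightarrow>
     (\<forall>x\<in>space (Rn n). \<forall>y\<in>space (Rn n). f (vadd n x y) = f x + f y)"

definition homogeneous_Rn :: "nat \<Rightarrow> (point \<Rightarrow> real) \<Rightarrow> bool" where
  "homogeneous_Rn n f \<longleftrightarrow> (\<forall>x\<in>space (Rn n). \<forall>c. f (vscale n c x) = c * f x)"

definition linear_Rn :: "nat \<Rightarrow> (point \<Rightarrow> real) \<Rightarrow> bool" where
  "linear_Rn n f \<longleftrightarrow> additive_Rn n f \<and> homogeneous_Rn n f"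

definition continuous_Rn :: "nat \<Rightarrow> (point \<Rightarrow> real) \<Rightarrow> bool" where
  "continuous_Rn n f \<longleftrightarrow>
     continuous_map (product_topology (\<lambda>i. euclideanreal) {..<n}) euclideanreal f"

definition distribution_on :: "nat \<Rightarrow> point measure \<Rightarrow> bool" where
  "distribution_on n D \<longleftrightarrow> prob_space D \<and> sets D = sets (Rn n)"

definition far :: "nat \<Rightarrow> point measure \<Rightarrow> ((point \<Rightarrow> real) \<Rightarrow> bool) \<Rightarrow> real \<Rightarrow> (point \<Rightarrow> real) \<Rightarrow> bool" where
  "far n D P \<epsilon> f \<longleftrightarrow>
     (\<forall>g\<in>borel_measurable (Rn n). P g \<longrightarrow> measure D {x\<in>space D. f x \<noteq> g x} > \<epsilon>)"

text \<open>
  A randomized algorithm is an adaptive decision tree: it stops with a verdict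
  (\<open>True\<close> means accept), queries \<open>f\<close> at a point and continues according to the answer, or
  requests a fresh independent sample from the unknown distribution or from the standard
  Gaussian. Internal randomness comes from Gaussian samples. Every branch is finite, so
  every run halts. The unknown function and distribution are accessible only through
  these nodes.
\<close>

datatype algo =
    Verdict bool
  | Query point "real \<Rightarrow> algo"
  | Sample "point \<Rightarrow> algo"
  | Sample_Gauss "point \<Rightarrow> algo"

primrec run :: "nat \<Rightarrow> (point \<Rightarrow> real) \<Rightarrow> point measure \<Rightarrow> algo \<Rightarrow> bool measure" where
  "run n f D (Verdict b) = return (count_space UNIV) b"
| "run n f D (Query x k) = run n f D (k (f x))"
| "run n f D (Sample k) = D \<bind> (\<lambda>x. run n f D (k x))"
| "run n f D (Sample_Gauss k) = gaussian n \<bind> (\<lambda>x. run n f D (k x))"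

text \<open>
  \<open>bind\<close> is only meaningful for measurable kernels. A tree is well posed on an input if
  this holds at all its sampling nodes and all query points lie in \<open>\<real>\<^sup>n\<close>; then \<open>run\<close> is a
  probability distribution on verdicts.
\<close>

primrec well_posed :: "nat \<Rightarrow> (point \<Rightarrow> real) \<Rightarrow> point measure \<Rightarrow> algo \<Rightarrow> bool" where
  "well_posed n f D (Verdict b) \<longleftrightarrow> True"
| "well_posed n f D (Query x k) \<longleftrightarrow> x \<in> space (Rn n) \<and> well_posed n f D (k (f x))"
| "well_posed n f D (Sample k) \<longleftrightarrow>
     (\<lambda>x. run n f D (k x)) \<in> D \<rightarrow>\<^sub>M prob_algebra (count_space UNIV) \<and>
     (\<forall>x\<in>space (Rn n). well_posed n f D (k x))"
| "well_posed n f D (Sample_Gauss k) \<longleftrightarrow>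
     (\<lambda>x. run n f D (k x)) \<in> gaussian n \<rightarrow>\<^sub>M prob_algebra (count_space UNIV) \<and>
     (\<forall>x\<in>space (Rn n). well_posed n f D (k x))"

text \<open>Worst case over all samples and all answers; only queries to \<open>f\<close> are counted.\<close>

primrec queries_le :: "nat \<Rightarrow> algo \<Rightarrow> nat \<Rightarrow> bool" where
  "queries_le n (Verdict b) q \<longleftrightarrow> True"
| "queries_le n (Query x k) q \<longleftrightarrow> q > 0 \<and> (\<forall>y. queries_le n (k y) (q - 1))"
| "queries_le n (Sample k) q \<longleftrightarrow> (\<forall>x\<in>space (Rn n). queries_le n (k x) q)"
| "queries_le n (Sample_Gauss k) q \<longleftrightarrow> (\<forall>x\<in>space (Rn n). queries_le n (k x) q)"

text \<open>
  \<open>promise\<close> is what the input function is guaranteed to satisfy. The tree may depend on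
  \<open>\<epsilon>\<close> but not on \<open>f\<close> or \<open>D\<close>.
\<close>

definition distribution_free_tester ::
  "nat \<Rightarrow> ((point \<Rightarrow> real) \<Rightarrow> bool) \<Rightarrow> ((point \<Rightarrow> real) \<Rightarrow> bool) \<Rightarrow> (real \<Rightarrow> algo) \<Rightarrow> bool" where
  "distribution_free_tester n promise P T \<longleftrightarrow>
     (\<forall>\<epsilon>>0. \<forall>f D. promise f \<longrightarrow> distribution_on n D \<longrightarrow>
        well_posed n f D (T \<epsilon>) \<and>
        (P f \<longrightarrow> measure (run n f D (T \<epsilon>)) {True} \<ge> 2/3) \<and>
        (far n D P \<epsilon> f \<longrightarrow> measure (run n f D (T \<epsilon>)) {False} \<ge> 2/3))"

definition one_sided ::
  "nat \<Rightarrow> ((point \<Rightarrow> real) \<Rightarrow> bool) \<Rightarrow> ((point \<Rightarrow> real) \<Rightarrow> bool) \<Rightarrow> (real \<Rightarrow> algo) \<Rightarrow> bool" where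
  "one_sided n promise P T \<longleftrightarrow>
     (\<forall>\<epsilon>>0. \<forall>f D. promise f \<longrightarrow> distribution_on n D \<longrightarrow> P f \<longrightarrow>
        measure (run n f D (T \<epsilon>)) {True} = 1)"

end

(*
  One round draws z, w from the Gaussian and x from D, and checks f z + f w = f (z + w) and
  f x = k * (f (z + x/k) - f z), where k depends on x and is so large that the shift by x/k
  changes Gaussian probabilities by at most 1/100. If the first check fails with probability at
  most 1/100, then for every small p the difference f (z + p) - f z takes one value g p with
  probability at least 19/20 over z. This g is additive, and continuous at 0 because f is
  continuous, so it is the restriction of a linear function L. Hence the second check fails with
  probability at least 19/20 at every x with f x \<noteq> L x. A round therefore rejects an epsilon-far
  function with probability at least epsilon/100, and 200/epsilon rounds suffice.
*)

theory Submission
  imports Defs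
begin

text \<open>The obstacle is that Gaussian samples only control \<open>f\<close> where the Gaussian
  has mass, while \<open>D\<close> may live anywhere: for large \<open>x\<close> the point
  \<open>z + x\<close> is not distributed like a Gaussian point, so \<open>f (z + x) - f z\<close>
  says nothing reliable about \<open>x\<close>. Dividing by \<open>k\<close> brings every
  \<open>x\<close> into the range where a shift is harmless, and homogeneity of \<open>L\<close>
  carries the value at \<open>x/k\<close> back to \<open>x\<close>. The allowed size of a coordinate
  shrinks like 1/n, which keeps the effect of a shift, and with it the number of rounds, independent
  of the dimension. The constants fit together as follows. A majority value exists because two
  shifted instances of the first check fail with total probability at most 2 * (1/100 + 1/100) =
  1/25 < 1/20. Majority values add up because 3 * 1/20 + 1/100 < 1. The two checks of a round share
  \<open>z\<close> and are not independent. Soundness never combines their failure probabilities: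
  either the first check alone fails often enough, or the second one does.\<close>

lemma prob_space_gaussian: "prob_space (gaussian n)"
  unfolding gaussian_def by (intro prob_space_PiM prob_space_normal_density) simp

lemma sets_gaussian [measurable_cong, simp]: "sets (gaussian n) = sets (Rn n)"
  unfolding gaussian_def Rn_def by (intro sets_PiM_cong) simp_all

lemma space_gaussian [simp]: "space (gaussian n) = space (Rn n)"
  by (rule sets_eq_imp_space_eq) simp

lemma space_Rn: "space (Rn n) = PiE {..<n} (\<lambda>_. UNIV)"
  by (simp add: Rn_def space_PiM)

lemma vadd_in_space [simp]: "vadd n x y \<in> space (Rn n)"
  by (simp add: vadd_def space_Rn)

lemma vscale_in_space [simp]: "vscale n c x \<in> space (Rn n)"
  by (simp add: vscale_def space_Rn)

section \<open>Measurable and continuous functions on \<real>^n\<close>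

lemma measurable_Rn_component: "i < n \<Longrightarrow> (\<lambda>x. x i) \<in> borel_measurable (Rn n)"
  unfolding Rn_def by (intro measurable_component_singleton) simp

lemma measurable_vadd [measurable (raw)]:
  assumes "f \<in> M \<rightarrow>\<^sub>M Rn n" "g \<in> M \<rightarrow>\<^sub>M Rn n"
  shows "(\<lambda>x. vadd n (f x) (g x)) \<in> M \<rightarrow>\<^sub>M Rn n"
proof -
  have "(\<lambda>x. f x i) \<in> borel_measurable M" "(\<lambda>x. g x i) \<in> borel_measurable M" if "i < n" for i
    using assms[THEN measurable_compose, OF measurable_Rn_component[OF that]] by simp_all
  then show ?thesis
    unfolding vadd_def Rn_def by (intro measurable_restrict borel_measurable_add) auto
qed

lemma measurable_vscale [measurable (raw)]:
  assumes "c \<in> borel_measurable M" "f \<in> M \<rightarrow>\<^sub>M Rn n"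
  shows "(\<lambda>x. vscale n (c x) (f x)) \<in> M \<rightarrow>\<^sub>M Rn n"
proof -
  have "(\<lambda>x. f x i) \<in> borel_measurable M" if "i < n" for i
    using assms(2)[THEN measurable_compose, OF measurable_Rn_component[OF that]] by simp
  then show ?thesis
    unfolding vscale_def Rn_def using assms(1) by (intro measurable_restrict borel_measurable_times) auto
qed

text \<open>Continuity refers to the product topology over \<open>{..<n}\<close>, but continuity
  implies Borel measurability for the topology of the whole type. Composing \<open>f\<close> with
  restriction to \<open>{..<n}\<close> gives a continuous function on all sequences, where the Borel
  sets are those of the countable product. Padding with zeros embeds \<real>^n measurably, and
  restriction undoes the padding.\<close>

lemma continuous_Rn_measurable:
  assumes "continuous_Rn n f"
  shows "f \<in> borel_measurable (Rn n)"
proof -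
  let ?ext = "\<lambda>x i. if i < n then x i else (0::real)"
  have "continuous_map euclidean (product_topology (\<lambda>i. euclideanreal) {..<n})
          (\<lambda>x. restrict x {..<n})"
    by (subst continuous_map_componentwise)
       (auto simp: continuous_on_product_coordinates)
  then have "continuous_on UNIV (\<lambda>x. f (restrict x {..<n}))"
    using assms continuous_map_compose[of euclidean _ _ euclideanreal f]
    by (simp add: continuous_Rn_def comp_def)
  then have "(\<lambda>x. f (restrict x {..<n})) \<in> borel_measurable (PiM UNIV (\<lambda>_. borel))"
    using borel_measurable_continuous_onI measurable_cong_sets[OF sets_PiM_equal_borel refl]
    by blast
  moreover have "?ext \<in> Rn n \<rightarrow>\<^sub>M PiM UNIV (\<lambda>_. borel)"
  proof (rule measurable_PiM_single')
    show "(\<lambda>x. if i < n then x i else 0) \<in> borel_measurable (Rn n)" for i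
      by (cases "i < n") (simp_all add: measurable_Rn_component)
  qed simp
  ultimately have "(\<lambda>x. f (restrict (?ext x) {..<n})) \<in> borel_measurable (Rn n)"
    by (rule measurable_compose[rotated])
  moreover have "restrict (?ext x) {..<n} = x" if "x \<in> space (Rn n)" for x
    using that by (auto simp: space_Rn PiE_def extensional_def restrict_def)
  ultimately show ?thesis
    by (subst measurable_cong[of _ _ "\<lambda>x. f (restrict (?ext x) {..<n})"]) simp_all
qed

text \<open>Transfers the abstract continuity of \<open>f\<close> to ordinary continuity in one real
  parameter. It is needed for the lines obtained by moving a point along a coordinate axis.\<close>

lemma continuous_Rn_along:
  assumes "continuous_Rn n f" and "\<And>i. i < n \<Longrightarrow> continuous_on UNIV (\<lambda>t. c t i)"
    and "\<And>t. c t \<in> space (Rn n)"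
  shows "continuous_on UNIV (\<lambda>t::real. f (c t))"
proof -
  have "continuous_map euclideanreal (product_topology (\<lambda>i. euclideanreal) {..<n}) c"
    using assms(2,3) by (subst continuous_map_componentwise) (auto simp: space_Rn PiE_def)
  then show ?thesis
    using assms(1) continuous_map_compose[of euclideanreal _ c euclideanreal f]
    by (simp add: continuous_Rn_def comp_def)
qed

section \<open>Shifts of the Gaussian\<close>

text \<open>The likelihood ratio of the normal distribution with mean \<open>t\<close> and variance
  1 against the standard normal one.\<close>

definition normal_ratio :: "real \<Rightarrow> real \<Rightarrow> real" where
  "normal_ratio t x = exp (t * x - t\<^sup>2 / 2)"

lemma normal_ratio_measurable [measurable]: "normal_ratio t \<in> borel_measurable borel"
  unfolding normal_ratio_def by measurable

text \<open>Translation invariance of Lebesgue measure moves the shift into the density, and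
  completing the square splits off the likelihood ratio.\<close>

lemma std_normal_shift:
  assumes [measurable]: "A \<in> sets borel"
  shows "emeasure std_normal_distribution {x. x + t \<in> A} =
    (\<integral>\<^sup>+ x. ennreal (normal_ratio t x) * indicator A x \<partial>std_normal_distribution)"
proof -
  have "emeasure std_normal_distribution {x. x + t \<in> A} =
      (\<integral>\<^sup>+ x. ennreal (std_normal_density x) * indicator A (x + t) \<partial>lborel)"
    by (subst emeasure_density) (auto intro!: nn_integral_cong split: split_indicator)
  also have "\<dots> = (\<integral>\<^sup>+ x. ennreal (std_normal_density (x - t)) * indicator A x \<partial>lborel)"
    using nn_integral_real_affine[of "\<lambda>x. ennreal (std_normal_density (x - t)) * indicator A x" 1 t]
    by (simp add: add.commute)
  also have "\<dots> = (\<integral>\<^sup>+ x. ennreal (std_normal_density x) *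
      (ennreal (normal_ratio t x) * indicator A x) \<partial>lborel)"
  proof (intro nn_integral_cong)
    fix x
    have "std_normal_density (x - t) = std_normal_density x * normal_ratio t x"
    proof -
      have "- (x - t)\<^sup>2 / 2 = - x\<^sup>2 / 2 + (t * x - t\<^sup>2 / 2)"
        by (simp add: power2_eq_square field_simps)
      then show ?thesis
        by (simp only: std_normal_density_def normal_ratio_def exp_add mult.assoc)
    qed
    then show "ennreal (std_normal_density (x - t)) * indicator A x =
        ennreal (std_normal_density x) * (ennreal (normal_ratio t x) * indicator A x)"
      by (simp add: ennreal_mult normal_ratio_def mult.assoc)
  qed
  also have "\<dots> = (\<integral>\<^sup>+ x. ennreal (normal_ratio t x) * indicator A x \<partial>std_normal_distribution)"
    by (subst nn_integral_density) auto
  finally show ?thesis .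
qed

text \<open>Both sides are the product of the same tilted one-dimensional normal laws
  \<open>?N i\<close>. Since a product measure is determined by its values on boxes, each side is
  computed on a box and reduced to \<open>std_normal_shift\<close> coordinate by coordinate.\<close>

lemma gaussian_shift_density:
  assumes p: "p \<in> space (Rn n)"
  shows "distr (gaussian n) (Rn n) (\<lambda>z. vadd n z p) =
    density (gaussian n) (\<lambda>z. \<Prod>i<n. ennreal (normal_ratio (p i) (z i)))"
proof -
  let ?N = "\<lambda>i. density std_normal_distribution (\<lambda>x. ennreal (normal_ratio (p i) x))"
  \<comment> \<open>Total mass one is the case \<open>A = UNIV\<close> of
    \<open>std_normal_shift\<close>.\<close>
  have prob: "prob_space (?N i)" for i
    using std_normal_shift[of UNIV "p i"] prob_space.emeasure_space_1[OF prob_space_normal_density[of 1 0]]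
    by (intro prob_spaceI) (simp add: emeasure_density)
  interpret N: product_sigma_finite ?N
    unfolding product_sigma_finite_def using prob by (auto intro: prob_space_imp_sigma_finite)
  interpret G: product_sigma_finite "\<lambda>_. std_normal_distribution"
    unfolding product_sigma_finite_def
    using prob_space_normal_density[of 1 0] by (auto intro: prob_space_imp_sigma_finite)
  have N_eq: "emeasure (?N i) S = (\<integral>\<^sup>+ x. ennreal (normal_ratio (p i) x) * indicator S x \<partial>std_normal_distribution)"
    if "S \<in> sets borel" for i S
    using that by (intro emeasure_density) auto
  have sets_N: "sets (PiM {..<n} ?N) = sets (Rn n)"
    unfolding Rn_def by (intro sets_PiM_cong) simp_all
  have "distr (gaussian n) (Rn n) (\<lambda>z. vadd n z p) = PiM {..<n} ?N"
  proof (rule N.PiM_eqI)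
    fix A assume "\<And>i. i \<in> {..<n} \<Longrightarrow> A i \<in> sets (?N i)"
    then have A [measurable]: "\<And>i. i \<in> {..<n} \<Longrightarrow> A i \<in> sets borel"
      by simp
    have box: "PiE {..<n} A \<in> sets (Rn n)"
      unfolding Rn_def by (intro sets_PiM_I_finite) (auto simp: A)
    have "(\<lambda>z. vadd n z p) \<in> gaussian n \<rightarrow>\<^sub>M Rn n"
      using p by measurable
    moreover have "(\<lambda>z. vadd n z p) -` PiE {..<n} A \<inter> space (gaussian n) =
        PiE {..<n} (\<lambda>i. {x. x + p i \<in> A i})"
      unfolding space_gaussian space_Rn vimage_def set_eq_iff Int_iff mem_Collect_eq PiE_iff vadd_def
      by (simp add: ac_simps)
    ultimately have "emeasure (distr (gaussian n) (Rn n) (\<lambda>z. vadd n z p)) (PiE {..<n} A) =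
        emeasure (gaussian n) (PiE {..<n} (\<lambda>i. {x. x + p i \<in> A i}))"
      using box by (simp add: emeasure_distr)
    also have "\<dots> = (\<Prod>i<n. emeasure std_normal_distribution {x. x + p i \<in> A i})"
      unfolding gaussian_def by (intro G.emeasure_PiM) auto
    also have "\<dots> = (\<Prod>i<n. emeasure (?N i) (A i))"
      using A by (intro prod.cong refl) (simp only: std_normal_shift N_eq)
    finally show "emeasure (distr (gaussian n) (Rn n) (\<lambda>z. vadd n z p)) (PiE {..<n} A) =
        (\<Prod>i<n. emeasure (?N i) (A i))" .
  qed (simp_all add: sets_N)
  moreover have "density (gaussian n) (\<lambda>z. \<Prod>i<n. ennreal (normal_ratio (p i) (z i))) = PiM {..<n} ?N"
  proof (rule N.PiM_eqI)
    fix A assume "\<And>i. i \<in> {..<n} \<Longrightarrow> A i \<in> sets (?N i)"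
    then have A [measurable]: "\<And>i. i \<in> {..<n} \<Longrightarrow> A i \<in> sets borel"
      by simp
    have box: "PiE {..<n} A \<in> sets (Rn n)"
      unfolding Rn_def by (intro sets_PiM_I_finite) (auto simp: A)
    have "emeasure (density (gaussian n) (\<lambda>z. \<Prod>i<n. ennreal (normal_ratio (p i) (z i)))) (PiE {..<n} A) =
        (\<integral>\<^sup>+ z. (\<Prod>i<n. ennreal (normal_ratio (p i) (z i))) * indicator (PiE {..<n} A) z \<partial>gaussian n)"
      using box
      by (intro emeasure_density borel_measurable_prod_ennreal measurable_compose[OF _ measurable_ennreal]
          measurable_compose[OF _ normal_ratio_measurable])
         (simp_all add: measurable_Rn_component cong: measurable_cong_sets)
    also have "\<dots> = (\<integral>\<^sup>+ z. (\<Prod>i<n. ennreal (normal_ratio (p i) (z i)) * indicator (A i) (z i)) \<partial>gaussian n)"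
    proof (intro nn_integral_cong)
      fix z assume "z \<in> space (gaussian n)"
      then have "z \<in> PiE {..<n} A \<longleftrightarrow> (\<forall>i\<in>{..<n}. z i \<in> A i)"
        unfolding space_gaussian space_Rn PiE_iff by simp
      then have "indicator (PiE {..<n} A) z = (\<Prod>i<n. indicator (A i) (z i) :: ennreal)"
        by (cases "z \<in> PiE {..<n} A") (auto simp: indicator_def)
      then show "(\<Prod>i<n. ennreal (normal_ratio (p i) (z i))) * indicator (PiE {..<n} A) z =
          (\<Prod>i<n. ennreal (normal_ratio (p i) (z i)) * indicator (A i) (z i))"
        by (simp add: prod.distrib)
    qed
    also have "\<dots> = (\<Prod>i<n. \<integral>\<^sup>+ x. ennreal (normal_ratio (p i) x) * indicator (A i) x \<partial>std_normal_distribution)"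
      unfolding gaussian_def by (intro G.product_nn_integral_prod) auto
    also have "\<dots> = (\<Prod>i<n. emeasure (?N i) (A i))"
      using A by (intro prod.cong refl) (simp only: N_eq)
    finally show "emeasure (density (gaussian n) (\<lambda>z. \<Prod>i<n. ennreal (normal_ratio (p i) (z i)))) (PiE {..<n} A) =
        (\<Prod>i<n. emeasure (?N i) (A i))" .
  qed (simp_all add: sets_N)
  ultimately show ?thesis by simp
qed

text \<open>The exact value is sqrt (2 / pi), which is below 1 because pi > 3.\<close>

lemma nn_integral_abs_std_normal: "(\<integral>\<^sup>+ x. ennreal \<bar>x\<bar> \<partial>std_normal_distribution) \<le> 1"
proof -
  have "(\<integral>\<^sup>+ x. ennreal \<bar>x\<bar> \<partial>std_normal_distribution) =
      (\<integral>\<^sup>+ x. ennreal (std_normal_density x * \<bar>x\<bar>) \<partial>lborel)"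
    by (subst nn_integral_density) (auto simp: ennreal_mult)
  also have "\<dots> = ennreal (sqrt (2 / pi))"
    using std_normal_moment_abs_odd[of 0] by (simp add: nn_integral_eq_integral has_bochner_integral_iff)
  also have "\<dots> \<le> 1"
    using pi_gt3 by simp
  finally show ?thesis .
qed

lemma nn_integral_gaussian_component:
  assumes "i < n" and [measurable]: "f \<in> borel_measurable borel"
  shows "(\<integral>\<^sup>+ z. f (z i) \<partial>gaussian n) = (\<integral>\<^sup>+ x. f x \<partial>std_normal_distribution)"
proof -
  interpret product_prob_space "\<lambda>_. std_normal_distribution" "{..<n}"
    using prob_space_normal_density[of 1 0] by (intro product_prob_spaceI) simp
  have "(\<integral>\<^sup>+ x. f x \<partial>std_normal_distribution) =
      (\<integral>\<^sup>+ x. f x \<partial>distr (gaussian n) std_normal_distribution (\<lambda>z. z i))"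
    using assms(1) by (simp add: gaussian_def PiM_component)
  also have "\<dots> = (\<integral>\<^sup>+ z. f (z i) \<partial>gaussian n)"
    using assms(1) by (subst nn_integral_distr) (simp_all add: gaussian_def)
  finally show ?thesis by simp
qed

text \<open>The bound on a coordinate is chosen so that twice the sum of all \<bar>p i\<bar> is at
  most 1/100, whatever the dimension.\<close>

definition small_shift :: "nat \<Rightarrow> point \<Rightarrow> bool" where
  "small_shift n p \<longleftrightarrow> p \<in> space (Rn n) \<and> (\<forall>i<n. \<bar>p i\<bar> \<le> 1 / (200 * real n))"

text \<open>The density of the shifted Gaussian is bounded below by \<open>exp y \<ge> 1 + y\<close>, which gives
  the constant \<open>2 * (\<Sum>i<n. \<bar>p i\<bar>)\<close> from first absolute moments only.\<close>

lemma gaussian_le_shift: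
  assumes p: "small_shift n p" and B [measurable]: "B \<in> sets (Rn n)"
  shows "emeasure (gaussian n) B \<le>
    emeasure (gaussian n) {z \<in> space (Rn n). vadd n z p \<in> B} + ennreal (1 / 100)"
proof -
  let ?H = "\<lambda>z. \<Prod>i<n. ennreal (normal_ratio (p i) (z i))"
  let ?R = "\<lambda>z. \<Sum>i<n. ennreal \<bar>p i\<bar> * (ennreal \<bar>z i\<bar> + 1)"
  note [measurable] = measurable_Rn_component
  have H [measurable]: "?H \<in> borel_measurable (gaussian n)"
    by (intro borel_measurable_prod_ennreal measurable_compose[OF _ measurable_ennreal]
          measurable_compose[OF _ normal_ratio_measurable])
       (simp_all add: measurable_Rn_component cong: measurable_cong_sets)
  have abs_i [measurable]: "(\<lambda>z. ennreal \<bar>z i\<bar>) \<in> borel_measurable (gaussian n)" if "i < n" for i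
    using measurable_Rn_component[OF that] by (simp cong: measurable_cong_sets)
  have R [measurable]: "?R \<in> borel_measurable (gaussian n)"
    by (intro borel_measurable_sum borel_measurable_times borel_measurable_add) (auto intro: abs_i)
  have le1: "\<bar>p i\<bar> \<le> 1" if "i < n" for i
  proof -
    have "\<bar>p i\<bar> \<le> 1 / (200 * real n)"
      using p that by (simp add: small_shift_def)
    also have "\<dots> \<le> 1"
      using that by (simp add: field_simps)
    finally show ?thesis .
  qed
  have one_le: "1 \<le> ?H z + ?R z" for z
  proof -
    have "1 + (\<Sum>i<n. p i * z i - (p i)\<^sup>2 / 2) \<le> exp (\<Sum>i<n. p i * z i - (p i)\<^sup>2 / 2)"
      by (rule exp_ge_add_one_self)
    also have "\<dots> = (\<Prod>i<n. normal_ratio (p i) (z i))"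
      by (simp add: exp_sum normal_ratio_def)
    finally have "1 \<le> (\<Prod>i<n. normal_ratio (p i) (z i)) + (\<Sum>i<n. - (p i * z i - (p i)\<^sup>2 / 2))"
      unfolding sum_negf by linarith
    \<comment> \<open>Since \<bar>p i\<bar> \<le> 1, the quadratic term is also of first order in
      \<bar>p i\<bar>; it accounts for the summand 1 beside \<bar>z i\<bar>.\<close>
    also have "(\<Sum>i<n. - (p i * z i - (p i)\<^sup>2 / 2)) \<le> (\<Sum>i<n. \<bar>p i\<bar> * (\<bar>z i\<bar> + 1))"
    proof (intro sum_mono)
      fix i assume "i \<in> {..<n}"
      then have "\<bar>p i\<bar> * \<bar>p i\<bar> \<le> \<bar>p i\<bar> * 1"
        using le1 by (intro mult_left_mono) auto
      then have "(p i)\<^sup>2 \<le> \<bar>p i\<bar>"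
        by (simp add: power2_eq_square flip: abs_mult)
      moreover have "- (p i * z i) \<le> \<bar>p i\<bar> * \<bar>z i\<bar>"
        by (metis abs_ge_minus_self abs_mult)
      ultimately show "- (p i * z i - (p i)\<^sup>2 / 2) \<le> \<bar>p i\<bar> * (\<bar>z i\<bar> + 1)"
        by (simp add: algebra_simps)
    qed
    finally have "ennreal 1 \<le> ennreal ((\<Prod>i<n. normal_ratio (p i) (z i)) + (\<Sum>i<n. \<bar>p i\<bar> * (\<bar>z i\<bar> + 1)))"
      by (intro ennreal_leI) simp
    also have "\<dots> = ennreal (\<Prod>i<n. normal_ratio (p i) (z i)) + ennreal (\<Sum>i<n. \<bar>p i\<bar> * (\<bar>z i\<bar> + 1))"
      by (intro ennreal_plus prod_nonneg sum_nonneg) (auto simp: normal_ratio_def)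
    also have "\<dots> = ?H z + ?R z"
      by (simp add: prod_ennreal sum_ennreal normal_ratio_def flip: ennreal_mult ennreal_plus ennreal_1)
    finally show ?thesis by simp
  qed
  have "emeasure (gaussian n) B = (\<integral>\<^sup>+ z. indicator B z \<partial>gaussian n)"
    using B by simp
  also have "\<dots> \<le> (\<integral>\<^sup>+ z. ?H z * indicator B z + ?R z \<partial>gaussian n)"
    using one_le by (intro nn_integral_mono) (auto split: split_indicator)
  also have "\<dots> = (\<integral>\<^sup>+ z. ?H z * indicator B z \<partial>gaussian n) + (\<integral>\<^sup>+ z. ?R z \<partial>gaussian n)"
    by (intro nn_integral_add) auto
  also have "(\<integral>\<^sup>+ z. ?H z * indicator B z \<partial>gaussian n) = emeasure (density (gaussian n) ?H) B"
    by (intro emeasure_density[symmetric]) auto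
  also have "\<dots> = emeasure (distr (gaussian n) (Rn n) (\<lambda>z. vadd n z p)) B"
    using p by (subst gaussian_shift_density) (simp_all add: small_shift_def)
  also have "\<dots> = emeasure (gaussian n) {z \<in> space (Rn n). vadd n z p \<in> B}"
  proof (subst emeasure_distr)
    show "(\<lambda>z. vadd n z p) \<in> gaussian n \<rightarrow>\<^sub>M Rn n"
      using p by (intro measurable_vadd) (simp_all add: small_shift_def cong: measurable_cong_sets)
    have "(\<lambda>z. vadd n z p) -` B \<inter> space (gaussian n) = {z \<in> space (Rn n). vadd n z p \<in> B}"
      by auto
    then show "emeasure (gaussian n) ((\<lambda>z. vadd n z p) -` B \<inter> space (gaussian n)) =
        emeasure (gaussian n) {z \<in> space (Rn n). vadd n z p \<in> B}"
      by simp
  qed (rule B)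
  also have "(\<integral>\<^sup>+ z. ?R z \<partial>gaussian n) = (\<Sum>i<n. \<integral>\<^sup>+ z. ennreal \<bar>p i\<bar> * (ennreal \<bar>z i\<bar> + 1) \<partial>gaussian n)"
    by (intro nn_integral_sum) (auto intro!: borel_measurable_times borel_measurable_add abs_i)
  also have "\<dots> \<le> (\<Sum>i<n. ennreal (1 / (100 * real n)))"
  proof (intro sum_mono)
    fix i assume i: "i \<in> {..<n}"
    interpret prob_space "gaussian n" by (rule prob_space_gaussian)
    have "(\<integral>\<^sup>+ z. ennreal \<bar>p i\<bar> * (ennreal \<bar>z i\<bar> + 1) \<partial>gaussian n) =
        ennreal \<bar>p i\<bar> * ((\<integral>\<^sup>+ z. ennreal \<bar>z i\<bar> \<partial>gaussian n) + 1)"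
      using i abs_i by (subst nn_integral_cmult) (auto simp: nn_integral_add emeasure_space_1[simplified])
    also have "(\<integral>\<^sup>+ z. ennreal \<bar>z i\<bar> \<partial>gaussian n) \<le> 1"
      using i nn_integral_abs_std_normal
        nn_integral_gaussian_component[of i n "\<lambda>x. ennreal \<bar>x\<bar>"] by simp
    also have "ennreal \<bar>p i\<bar> * (1 + 1) \<le> ennreal (1 / (200 * real n)) * ennreal 2"
      using i p by (intro mult_mono ennreal_leI) (auto simp: small_shift_def)
    also have "\<dots> = ennreal (1 / (100 * real n))"
      by (subst ennreal_mult[symmetric]) auto
    finally show "(\<integral>\<^sup>+ z. ennreal \<bar>p i\<bar> * (ennreal \<bar>z i\<bar> + 1) \<partial>gaussian n) \<le> ennreal (1 / (100 * real n))"
      by (auto simp: mult_left_mono add_right_mono)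
  qed
  also have "\<dots> \<le> ennreal (1 / 100)"
    by (cases "n = 0") (simp_all add: ennreal_of_nat_eq_real_of_nat flip: ennreal_mult)
  finally show ?thesis
    by (auto simp: add_left_mono)
qed

text \<open>The lower bound of \<open>gaussian_le_shift\<close>, applied to the complement of
  \<open>B\<close>, becomes an upper bound for \<open>B\<close>.\<close>

lemma gaussian_shift_le:
  assumes p: "small_shift n p" and B: "B \<in> sets (Rn n)"
  shows "measure (gaussian n) {z \<in> space (Rn n). vadd n z p \<in> B} \<le> measure (gaussian n) B + 1 / 100"
proof -
  interpret prob_space "gaussian n" by (rule prob_space_gaussian)
  let ?S = "{z \<in> space (Rn n). vadd n z p \<in> B}" and ?C = "space (Rn n) - B"
  have p': "p \<in> space (Rn n)"
    using p by (simp add: small_shift_def)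
  have S: "?S \<in> events"
    using p' B by simp measurable
  have C: "?C \<in> sets (Rn n)"
    using B sets.compl_sets by blast
  have "{z \<in> space (Rn n). vadd n z p \<in> ?C} = space (gaussian n) - ?S"
    by auto
  then have "ennreal (prob ?C) \<le> ennreal (prob (space (gaussian n) - ?S) + 1 / 100)"
    using gaussian_le_shift[OF p C] by (simp add: emeasure_eq_measure flip: ennreal_plus)
  then have "prob ?C \<le> prob (space (gaussian n) - ?S) + 1 / 100"
    by (subst (asm) ennreal_le_iff) auto
  then show ?thesis
    using prob_compl[OF S] prob_compl[of B] B by simp
qed

section \<open>Majority differences\<close>

text \<open>Cauchy's functional equation on an interval. Additivity determines \<phi> on the grid of
  multiples of r / (k + 1), and continuity at 0 removes the remainder as the grid gets finer.
  Additivity is only available while all arguments stay in [-r, r], so one cannot multiply up to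
  large arguments, and every grid point used has to be checked to lie in range.\<close>

lemma locally_additive_imp_linear:
  fixes \<phi> :: "real \<Rightarrow> real"
  assumes "r > 0"
    and add: "\<And>s t. \<bar>s\<bar> \<le> r \<Longrightarrow> \<bar>t\<bar> \<le> r \<Longrightarrow> \<bar>s + t\<bar> \<le> r \<Longrightarrow> \<phi> (s + t) = \<phi> s + \<phi> t"
    and lim: "\<And>u :: nat \<Rightarrow> real. (\<And>k. \<bar>u k\<bar> \<le> r) \<Longrightarrow> u \<longlonglongrightarrow> 0 \<Longrightarrow> (\<lambda>k. \<phi> (u k)) \<longlonglongrightarrow> 0"
    and t: "\<bar>t\<bar> \<le> r"
  shows "\<phi> t = t / r * \<phi> r"
proof -
  have pos: "\<phi> t = t / r * \<phi> r" if t: "0 \<le> t" "t \<le> r" for t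
  proof -
    \<comment> \<open>\<open>m k\<close> is the index of the last grid point not exceeding
      \<open>t\<close>, and \<open>u k\<close> is the distance from there to \<open>t\<close>, at
      most one mesh width.\<close>
    define m where "m k = nat \<lfloor>real (Suc k) * t / r\<rfloor>" for k
    define u where "u k = t - real (m k) * (r / real (Suc k))" for k
    have m: "real (m k) \<le> real (Suc k) * t / r" "real (Suc k) * t / r \<le> real (m k) + 1" for k
      using t \<open>r > 0\<close> unfolding m_def by simp_all
    have u: "0 \<le> u k" "u k \<le> r / real (Suc k)" for k
    proof -
      have "u k = (real (Suc k) * t / r - real (m k)) * (r / real (Suc k))"
        using \<open>r > 0\<close> unfolding left_diff_distrib u_def by simp
      moreover have "0 \<le> (real (Suc k) * t / r - real (m k)) * (r / real (Suc k))"
        using m(1)[of k] \<open>r > 0\<close> by (intro mult_nonneg_nonneg) auto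
      moreover have "(real (Suc k) * t / r - real (m k)) * (r / real (Suc k)) \<le> 1 * (r / real (Suc k))"
        using m(2)[of k] \<open>r > 0\<close> by (intro mult_right_mono) auto
      ultimately show "0 \<le> u k" "u k \<le> r / real (Suc k)"
        by simp_all
    qed
    have u_le: "\<bar>u k\<bar> \<le> r" for k
    proof -
      have "r / real (Suc k) \<le> r / 1"
        using \<open>r > 0\<close> by (intro divide_left_mono) auto
      then show ?thesis
        using u[of k] by simp
    qed
    have frac: "real j * (r / real (Suc k)) \<le> r" if "j \<le> Suc k" for j k
    proof -
      have "real j * (r / real (Suc k)) \<le> real (Suc k) * (r / real (Suc k))"
        using that \<open>r > 0\<close> by (intro mult_right_mono) auto
      then show ?thesis by simp
    qed
    have mult: "\<phi> (real j * (r / real (Suc k))) = real j * \<phi> (r / real (Suc k))" if "j \<le> Suc k" for j k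
      using that
    proof (induction j)
      case 0
      show ?case using add[of 0 0] \<open>r > 0\<close> by simp
    next
      case (Suc j)
      have "real j * (r / real (Suc k)) \<le> r" "r / real (Suc k) \<le> r"
          "real j * (r / real (Suc k)) + r / real (Suc k) \<le> r"
        using Suc.prems frac[of j k] frac[of 1 k] frac[of "Suc j" k] by (simp_all add: distrib_right add_divide_distrib add.commute)
      then have "\<phi> (real j * (r / real (Suc k)) + r / real (Suc k)) =
          \<phi> (real j * (r / real (Suc k))) + \<phi> (r / real (Suc k))"
        using \<open>r > 0\<close> by (intro add) auto
      then show ?case
        using Suc by (simp add: distrib_right add_divide_distrib add.commute)
    qed
    have eq: "(t - u k) / r * \<phi> r + \<phi> (u k) = \<phi> t" for k
    proof -
      have "real (m k) * r \<le> real (Suc k) * t"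
        using m(1)[of k] \<open>r > 0\<close> by (simp add: field_simps)
      also have "\<dots> \<le> real (Suc k) * r"
        using t by (intro mult_left_mono) auto
      finally have mk: "m k \<le> Suc k"
        using \<open>r > 0\<close> by simp
      have split: "t = real (m k) * (r / real (Suc k)) + u k"
        by (simp add: u_def)
      have "\<bar>real (m k) * (r / real (Suc k))\<bar> \<le> r"
        using frac[OF mk] \<open>r > 0\<close> by simp
      then have "\<phi> t = \<phi> (real (m k) * (r / real (Suc k))) + \<phi> (u k)"
        using add[of "real (m k) * (r / real (Suc k))" "u k"] u_le[of k] t split by simp
      also have "\<phi> (real (m k) * (r / real (Suc k))) = real (m k) * \<phi> (r / real (Suc k))"
        by (rule mult[OF mk])
      also have "\<phi> (r / real (Suc k)) = \<phi> r / real (Suc k)"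
        using mult[of "Suc k" k] by (simp del: of_nat_Suc)
      also have "real (m k) * (\<phi> r / real (Suc k)) = (t - u k) / r * \<phi> r"
        using \<open>r > 0\<close> by (simp add: u_def)
      finally show ?thesis ..
    qed
    have "u \<longlonglongrightarrow> 0"
    proof (rule tendsto_sandwich[OF _ _ tendsto_const])
      show "(\<lambda>k. r / real (Suc k)) \<longlonglongrightarrow> 0"
        by (intro LIMSEQ_Suc lim_const_over_n)
    qed (simp_all only: u eventually_True)
    \<comment> \<open>By \<open>eq\<close> this sequence is constantly \<phi> t, so its limit is the
      claimed value of \<phi> t.\<close>
    then have "(\<lambda>k. (t - u k) / r * \<phi> r + \<phi> (u k)) \<longlonglongrightarrow> (t - 0) / r * \<phi> r + 0"
      using \<open>r > 0\<close> by (intro tendsto_intros lim u_le) auto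
    then have "(\<lambda>k::nat. \<phi> t) \<longlonglongrightarrow> (t - 0) / r * \<phi> r + 0"
      by (simp only: eq)
    then show ?thesis
      using LIMSEQ_unique[OF tendsto_const] by fastforce
  qed
  show ?thesis
  proof (cases "t \<ge> 0")
    case True
    then show ?thesis
      using t by (intro pos) auto
  next
    case False
    have "\<phi> (t + - t) = \<phi> t + \<phi> (- t)"
      using t \<open>r > 0\<close> by (intro add) auto
    moreover have "\<phi> 0 = 0"
      using pos[of 0] \<open>r > 0\<close> by simp
    ultimately show ?thesis
      using pos[of "- t"] False t by simp
  qed
qed

text \<open>Tonelli's theorem for the indicator of \<open>Q\<close>, phrased through the measures of
  its sections, the form in which the probabilities of the two checks appear.\<close>

lemma section_measures:
  assumes "prob_space M" "prob_space N"
    and Q: "Measurable.pred (M \<Otimes>\<^sub>M N) (\<lambda>(x, y). Q x y)"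
  shows "(\<lambda>x. emeasure N {y \<in> space N. Q x y}) \<in> borel_measurable M"
    and "(\<lambda>y. emeasure M {x \<in> space M. Q x y}) \<in> borel_measurable N"
    and "(\<integral>\<^sup>+ y. emeasure M {x \<in> space M. Q x y} \<partial>N) = (\<integral>\<^sup>+ x. emeasure N {y \<in> space N. Q x y} \<partial>M)"
proof -
  interpret M: prob_space M by fact
  interpret N: prob_space N by fact
  interpret pair_sigma_finite M N by unfold_locales
  let ?X = "{p \<in> space (M \<Otimes>\<^sub>M N). case p of (x, y) \<Rightarrow> Q x y}"
  have X: "?X \<in> sets (M \<Otimes>\<^sub>M N)"
    using Q by simp
  have 1: "Pair x -` ?X = {y \<in> space N. Q x y}" if "x \<in> space M" for x
    using that by (auto simp: space_pair_measure)
  have 2: "(\<lambda>x. (x, y)) -` ?X = {x \<in> space M. Q x y}" if "y \<in> space N" for y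
    using that by (auto simp: space_pair_measure)
  show "(\<lambda>x. emeasure N {y \<in> space N. Q x y}) \<in> borel_measurable M"
    by (rule measurable_cong[THEN iffD1, rotated, OF measurable_emeasure_Pair1[OF X]]) (simp only: 1)
  show "(\<lambda>y. emeasure M {x \<in> space M. Q x y}) \<in> borel_measurable N"
    by (rule measurable_cong[THEN iffD1, rotated, OF measurable_emeasure_Pair2[OF X]]) (simp only: 2)
  have "(\<integral>\<^sup>+ y. emeasure M {x \<in> space M. Q x y} \<partial>N) = emeasure (M \<Otimes>\<^sub>M N) ?X"
    unfolding emeasure_pair_measure_alt2[OF X] by (intro nn_integral_cong) (simp only: 2)
  also have "\<dots> = (\<integral>\<^sup>+ x. emeasure N {y \<in> space N. Q x y} \<partial>M)"
    unfolding N.emeasure_pair_measure_alt[OF X] by (intro nn_integral_cong) (simp only: 1)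
  finally show "(\<integral>\<^sup>+ y. emeasure M {x \<in> space M. Q x y} \<partial>N) = (\<integral>\<^sup>+ x. emeasure N {y \<in> space N. Q x y} \<partial>M)" .
qed

lemma vadd_commute: "vadd n x y = vadd n y x"
  by (simp add: vadd_def add.commute)

lemma vadd_assoc: "vadd n (vadd n x y) z = vadd n x (vadd n y z)"
  by (auto simp: vadd_def add.assoc)

lemma gaussian_shift_pred_le:
  assumes "small_shift n p" "{z \<in> space (Rn n). P z} \<in> sets (Rn n)"
  shows "emeasure (gaussian n) {z \<in> space (Rn n). P (vadd n z p)} \<le>
    emeasure (gaussian n) {z \<in> space (Rn n). P z} + ennreal (1 / 100)"
proof -
  interpret prob_space "gaussian n" by (rule prob_space_gaussian)
  show ?thesis
    using gaussian_shift_le[OF assms]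
    by (simp add: emeasure_eq_measure flip: ennreal_plus)
qed

text \<open>The failure probability of the first check. The inner probability runs over
  \<open>z\<close> for fixed \<open>w\<close>, so that a shift of \<open>z\<close> can be estimated
  before \<open>w\<close> is averaged out.\<close>

definition addition_defect :: "nat \<Rightarrow> (point \<Rightarrow> real) \<Rightarrow> ennreal" where
  "addition_defect n f =
    (\<integral>\<^sup>+ w. emeasure (gaussian n) {z \<in> space (Rn n). f z + f w \<noteq> f (vadd n z w)} \<partial>gaussian n)"

text \<open>A collision argument. Compare the differences at two independent points \<open>z\<close>
  and \<open>w\<close>. If \<open>f (z + p) + f w\<close> and \<open>f z + f (w + p)\<close> both
  equal the value of \<open>f\<close> at the common sum z + w + p, the two differences agree. Each
  equation is an instance of the first check with one shifted argument and fails with probability at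
  most 1/50. So a random \<open>w\<close> supplies a value \<open>v\<close> that is attained for
  most \<open>z\<close>.\<close>

lemma ex_majority_difference:
  assumes f [measurable]: "f \<in> borel_measurable (Rn n)"
    and defect: "addition_defect n f \<le> ennreal (1 / 100)"
    and p: "small_shift n p"
  shows "\<exists>v. measure (gaussian n) {z \<in> space (Rn n). f (vadd n z p) - f z \<noteq> v} \<le> 1 / 20"
proof (rule ccontr)
  assume none: "\<nexists>v. measure (gaussian n) {z \<in> space (Rn n). f (vadd n z p) - f z \<noteq> v} \<le> 1 / 20"
  interpret prob_space "gaussian n" by (rule prob_space_gaussian)
  let ?G = "gaussian n"
  have p_space: "p \<in> space (Rn n)"
    using p by (simp add: small_shift_def)
  have [measurable]: "(\<lambda>z. vadd n (g z) p) \<in> M \<rightarrow>\<^sub>M Rn n" if "g \<in> M \<rightarrow>\<^sub>M Rn n" for g and M :: "'z measure"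
    using that p_space by (intro measurable_vadd) auto
  let ?T = "\<lambda>z w. f z + f w \<noteq> f (vadd n z w)"
  let ?e = "\<lambda>w. emeasure ?G {z \<in> space (Rn n). ?T z w}"
  have T [measurable]: "Measurable.pred (?G \<Otimes>\<^sub>M ?G) (\<lambda>(z, w). ?T z w)"
    by measurable
  have T': "Measurable.pred (?G \<Otimes>\<^sub>M ?G) (\<lambda>(z, w). ?T z (vadd n w p))"
    by measurable
  have T_section [measurable]: "{z \<in> space (Rn n). ?T z w} \<in> sets (Rn n)" if "w \<in> space (Rn n)" for w
  proof -
    have "(\<lambda>z. f (vadd n z w)) \<in> borel_measurable (Rn n)"
      using that by (intro measurable_compose[OF _ f] measurable_vadd) auto
    then show ?thesis
      by (intro borel_measurable_neq) simp_all
  qed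
  have e [measurable]: "?e \<in> borel_measurable ?G"
    using section_measures(2)[OF prob_space_gaussian prob_space_gaussian T] by simp
  have e' [measurable]: "(\<lambda>w. ?e (vadd n w p)) \<in> borel_measurable ?G"
    using section_measures(2)[OF prob_space_gaussian prob_space_gaussian T'] by simp
  have sym: "?T z w = ?T w z" for z w
    by (simp add: vadd_commute[of n z] add.commute)
  have shift: "emeasure ?G {z \<in> space (Rn n). ?T (vadd n z p) w} \<le> ?e w + ennreal (1 / 100)"
    if "w \<in> space (Rn n)" for w
    using gaussian_shift_pred_le[OF p T_section[OF that]] .
  have int_shift: "(\<integral>\<^sup>+ w. ?e w + ennreal (1 / 100) \<partial>?G) \<le> ennreal (1 / 50)"
  proof -
    have "(\<integral>\<^sup>+ w. ?e w + ennreal (1 / 100) \<partial>?G) = addition_defect n f + ennreal (1 / 100)"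
      by (subst nn_integral_add) (simp_all add: addition_defect_def emeasure_space_1[simplified])
    also have "\<dots> \<le> ennreal (1 / 100) + ennreal (1 / 100)"
      using defect by (intro add_right_mono)
    finally show ?thesis by (simp flip: ennreal_plus)
  qed
  \<comment> \<open>Here the outer variable is the shifted one. Tonelli makes it the inner one, and
    the symmetry of \<open>?T\<close> reduces to the case estimated in \<open>shift\<close>.\<close>
  have "(\<integral>\<^sup>+ w. ?e (vadd n w p) \<partial>?G) = (\<integral>\<^sup>+ z. emeasure ?G {w \<in> space (Rn n). ?T z (vadd n w p)} \<partial>?G)"
    using section_measures(3)[OF prob_space_gaussian prob_space_gaussian T'] by simp
  also have "\<dots> \<le> (\<integral>\<^sup>+ w. ?e w + ennreal (1 / 100) \<partial>?G)"
    using shift by (intro nn_integral_mono) (simp add: sym[of _ "vadd n _ p"])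
  also note int_shift
  finally have int_e': "(\<integral>\<^sup>+ w. ?e (vadd n w p) \<partial>?G) \<le> ennreal (1 / 50)" .
  have "ennreal (1 / 20) \<le> (?e w + ennreal (1 / 100)) + ?e (vadd n w p)" if w: "w \<in> space (Rn n)" for w
  proof -
    let ?S = "{z \<in> space (Rn n). f (vadd n z p) - f z \<noteq> f (vadd n w p) - f w}"
    \<comment> \<open>The assumption \<open>none\<close> is used for the value
      \<open>f (vadd n w p) - f w\<close> read off at \<open>w\<close>.\<close>
    have "ennreal (1 / 20) \<le> emeasure ?G ?S"
      using none by (auto simp: emeasure_eq_measure not_le intro!: ennreal_leI less_imp_le)
    also have "\<dots> \<le> emeasure ?G ({z \<in> space (Rn n). ?T (vadd n z p) w} \<union> {z \<in> space (Rn n). ?T z (vadd n w p)})"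
    proof (rule emeasure_mono)
      have "vadd n (vadd n z p) w = vadd n z (vadd n w p)" for z
        by (simp add: vadd_assoc vadd_commute[of n p])
      then show "?S \<subseteq> {z \<in> space (Rn n). ?T (vadd n z p) w} \<union> {z \<in> space (Rn n). ?T z (vadd n w p)}"
        by auto
    qed (use w in simp)
    also have "\<dots> \<le> emeasure ?G {z \<in> space (Rn n). ?T (vadd n z p) w} + ?e (vadd n w p)"
      using w by (intro emeasure_subadditive) auto
    finally show ?thesis
      using shift[OF w] by (meson add_right_mono order_trans)
  qed
  then have "(\<integral>\<^sup>+ w. ennreal (1 / 20) \<partial>?G) \<le> (\<integral>\<^sup>+ w. (?e w + ennreal (1 / 100)) + ?e (vadd n w p) \<partial>?G)"
    by (intro nn_integral_mono) simp
  also have "\<dots> = (\<integral>\<^sup>+ w. ?e w + ennreal (1 / 100) \<partial>?G) + (\<integral>\<^sup>+ w. ?e (vadd n w p) \<partial>?G)"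
    by (intro nn_integral_add) auto
  also have "\<dots> \<le> ennreal (1 / 50) + ennreal (1 / 50)"
    by (intro add_mono int_shift int_e')
  finally have "ennreal (1 / 20) \<le> ennreal (1 / 25)"
    by (simp add: emeasure_space_1[simplified] flip: ennreal_plus)
  then show False
    by (subst (asm) ennreal_le_iff) auto
qed

section \<open>From majority values to a linear map\<close>

definition axis :: "nat \<Rightarrow> nat \<Rightarrow> real \<Rightarrow> point" where
  "axis n i t = (\<lambda>j\<in>{..<n}. if j = i then t else 0)"

lemma axis_in_space [simp]: "axis n i t \<in> space (Rn n)"
  by (simp add: axis_def space_Rn)

lemma vadd_axis: "vadd n (axis n i s) (axis n i t) = axis n i (s + t)"
  by (auto simp: vadd_def axis_def)

lemma small_shift_axis:
  assumes "\<bar>t\<bar> \<le> 1 / (200 * real n)"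
  shows "small_shift n (axis n i t)"
  using assms unfolding small_shift_def by (auto simp: axis_def space_Rn)

text \<open>The zero vector has no name of its own; \<open>axis n i 0\<close> stands for it, with
  any \<open>i\<close>.\<close>

lemma vadd_zero: "z \<in> space (Rn n) \<Longrightarrow> vadd n z (axis n i 0) = z"
  unfolding space_Rn PiE_iff extensional_def vadd_def axis_def by auto

text \<open>Identities between the numbers \<open>g p\<close> are proved by finding one point
  \<open>z\<close> at which all the differences involved take their majority values; it exists as
  soon as the exceptional sets cannot cover the space. The coefficients are the slopes of
  \<open>g\<close> along the coordinate axes.\<close>

lemma gaussian_differences_linear:
  assumes "n \<ge> 1" and f: "continuous_Rn n f"
    and defect: "addition_defect n f \<le> ennreal (1 / 100)"
  obtains a :: "nat \<Rightarrow> real" where "\<And>p. small_shift n p \<Longrightarrow>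
    measure (gaussian n) {z \<in> space (Rn n). f (vadd n z p) - f z \<noteq> (\<Sum>i<n. a i * p i)} \<le> 1 / 20"
proof -
  interpret prob_space "gaussian n" by (rule prob_space_gaussian)
  note f_meas [measurable] = continuous_Rn_measurable[OF f]
  define r where "r = 1 / (200 * real n)"
  have "r > 0"
    using \<open>n \<ge> 1\<close> by (simp add: r_def)
  have f_shift: "(\<lambda>z. f (vadd n z p)) \<in> borel_measurable (Rn n)" if "p \<in> space (Rn n)" for p
    using that by (intro measurable_compose[OF _ f_meas] measurable_vadd) auto
  have neq_sets: "{z \<in> space (Rn n). f (vadd n z p) - f z \<noteq> v} \<in> events" if "p \<in> space (Rn n)" for p v
  proof -
    have "{z \<in> space (Rn n). f (vadd n z p) - f z \<noteq> v} \<in> sets (Rn n)"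
      using f_shift[OF that] f_meas by (intro borel_measurable_neq borel_measurable_diff) auto
    then show ?thesis by simp
  qed
  obtain g where g: "\<And>p. small_shift n p \<Longrightarrow>
      prob {z \<in> space (Rn n). f (vadd n z p) - f z \<noteq> g p} \<le> 1 / 20"
  proof -
    have "\<forall>p. \<exists>v. small_shift n p \<longrightarrow> prob {z \<in> space (Rn n). f (vadd n z p) - f z \<noteq> v} \<le> 1 / 20"
      using ex_majority_difference[OF f_meas defect] by simp
    from choice[OF this] show thesis
      using that by auto
  qed
  have g_add: "g (vadd n p q) = g p + g q"
    if pq: "small_shift n p" "small_shift n q" "small_shift n (vadd n p q)" for p q
  proof (rule ccontr)
    assume neq: "g (vadd n p q) \<noteq> g p + g q"
    have sp: "p \<in> space (Rn n)" "q \<in> space (Rn n)"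
      using pq by (auto simp: small_shift_def)
    let ?D = "\<lambda>p. {z \<in> space (Rn n). f (vadd n z p) - f z \<noteq> g p}"
    \<comment> \<open>The difference for \<open>p + q\<close> at \<open>z\<close> is the difference
      for \<open>p\<close> at \<open>z\<close> plus the one for \<open>q\<close> at
      \<open>z + p\<close>. The exceptional set for \<open>q\<close> is therefore needed in shifted
      form, which costs another 1/100.\<close>
    let ?E = "{z \<in> space (Rn n). vadd n z p \<in> ?D q}"
    have E: "?E \<in> events"
    proof -
      have shift: "(\<lambda>z. vadd n z p) \<in> Rn n \<rightarrow>\<^sub>M Rn n"
        using sp by (intro measurable_vadd) auto
      have D: "?D q \<in> sets (Rn n)"
        using neq_sets[OF sp(2)] by simp
      have E_eq: "?E = (\<lambda>z. vadd n z p) -` ?D q \<inter> space (Rn n)"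
        by auto
      show ?thesis
        unfolding sets_gaussian E_eq by (rule measurable_sets[OF shift D])
    qed
    have "space (Rn n) \<subseteq> ?D p \<union> ?E \<union> ?D (vadd n p q)"
    proof
      fix z assume z: "z \<in> space (Rn n)"
      show "z \<in> ?D p \<union> ?E \<union> ?D (vadd n p q)"
        using z neq vadd_assoc[of n z p q] by (cases "z \<in> ?D p"; cases "z \<in> ?E") auto
    qed
    then have "prob (space (Rn n)) \<le> prob (?D p \<union> ?E \<union> ?D (vadd n p q))"
      using neq_sets sp E by (intro finite_measure_mono) auto
    also have "\<dots> \<le> prob (?D p \<union> ?E) + prob (?D (vadd n p q))"
      using neq_sets sp E by (intro measure_Un_le) auto
    also have "\<dots> \<le> (prob (?D p) + prob ?E) + prob (?D (vadd n p q))"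
      using neq_sets sp E by (intro add_right_mono measure_Un_le) auto
    also have "prob ?E \<le> prob (?D q) + 1 / 100"
      using neq_sets[OF sp(2)] by (intro gaussian_shift_le pq) simp
    finally have "prob (space (Rn n)) \<le> prob (?D p) + (prob (?D q) + 1 / 100) + prob (?D (vadd n p q))"
      by simp
    also have "\<dots> < 1"
      using g[OF pq(1)] g[OF pq(2)] g[OF pq(3)] by linarith
    finally show False
      using prob_space by simp
  qed
  have g_lim: "(\<lambda>k. g (axis n i (u k))) \<longlonglongrightarrow> 0"
    if u: "\<And>k. \<bar>u k\<bar> \<le> r" "u \<longlonglongrightarrow> 0" for u :: "nat \<Rightarrow> real" and i
  proof -
    \<comment> \<open>Truncation at 1 permits dominated convergence although \<open>f\<close> need
      not be integrable. Outside an event of probability at most 1/20 the integrand equals the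
      truncated \<bar>g\<bar>, so its expectation controls this single number.\<close>
    let ?X = "\<lambda>k z. min 1 \<bar>f (vadd n z (axis n i (u k))) - f z\<bar>"
    have X_meas: "?X k \<in> borel_measurable (gaussian n)" for k
    proof -
      have "?X k \<in> borel_measurable (Rn n)"
        using f_shift[of "axis n i (u k)"] f_meas
        by (intro borel_measurable_min borel_measurable_abs borel_measurable_diff) auto
      then show ?thesis
        by (simp cong: measurable_cong_sets)
    qed
    have X_lim: "(\<lambda>k. ?X k z) \<longlonglongrightarrow> 0" if z: "z \<in> space (Rn n)" for z
    proof -
      have "continuous_on UNIV (\<lambda>t. f (vadd n z (axis n i t)))"
      proof (rule continuous_Rn_along[OF f])
        show "continuous_on UNIV (\<lambda>t. vadd n z (axis n i t) j)" if "j < n" for j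
          using that by (cases "j = i") (simp_all add: vadd_def axis_def continuous_intros)
      qed simp
      then have "isCont (\<lambda>t. f (vadd n z (axis n i t))) 0"
        by (simp add: continuous_on_eq_continuous_at)
      then have "(\<lambda>k. f (vadd n z (axis n i (u k)))) \<longlonglongrightarrow> f (vadd n z (axis n i 0))"
        using u(2) by (rule isCont_tendsto_compose)
      then have "(\<lambda>k. f (vadd n z (axis n i (u k))) - f z) \<longlonglongrightarrow> f z - f z"
        by (intro tendsto_diff tendsto_const) (simp add: vadd_zero[OF z])
      then have "(\<lambda>k. ?X k z) \<longlonglongrightarrow> min 1 \<bar>f z - f z\<bar>"
        by (intro tendsto_min tendsto_const tendsto_rabs)
      then show ?thesis by simp
    qed
    have int_lim: "(\<lambda>k. expectation (?X k)) \<longlonglongrightarrow> expectation (\<lambda>z. 0)"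
      using X_meas X_lim by (intro integral_dominated_convergence[where w = "\<lambda>_. 1"]) auto
    have int_ge: "19 / 20 * min 1 \<bar>g (axis n i (u k))\<bar> \<le> expectation (?X k)" for k
    proof -
      let ?p = "axis n i (u k)"
      let ?D = "{z \<in> space (Rn n). f (vadd n z ?p) - f z \<noteq> g ?p}"
      have D: "?D \<in> events"
        by (intro neq_sets) simp
      have "prob ?D \<le> 1 / 20"
        using u(1)[of k] by (intro g small_shift_axis) (simp add: r_def)
      then have "19 / 20 \<le> prob (space (gaussian n) - ?D)"
        using prob_compl[OF D] by simp
      then have "19 / 20 * min 1 \<bar>g ?p\<bar> \<le> prob (space (gaussian n) - ?D) * min 1 \<bar>g ?p\<bar>"
        by (intro mult_right_mono) auto
      also have "\<dots> = expectation (\<lambda>z. indicator (space (gaussian n) - ?D) z * min 1 \<bar>g ?p\<bar>)"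
        using D by simp
      also have "\<dots> \<le> expectation (?X k)"
      proof (rule integral_mono)
        show "integrable (gaussian n) (\<lambda>z. indicator (space (gaussian n) - ?D) z * min 1 \<bar>g ?p\<bar>)"
          using D by (intro integrable_mult_left integrable_real_indicator) (auto simp: emeasure_eq_measure)
        show "integrable (gaussian n) (?X k)"
          using X_meas by (intro integrable_const_bound[where B = 1]) auto
      qed (auto split: split_indicator)
      finally show ?thesis .
    qed
    have "(\<lambda>k. min 1 \<bar>g (axis n i (u k))\<bar>) \<longlonglongrightarrow> 0"
    proof (rule tendsto_sandwich[OF _ _ tendsto_const])
      show "\<forall>\<^sub>F k in sequentially. 0 \<le> min 1 \<bar>g (axis n i (u k))\<bar>" by simp
      show "\<forall>\<^sub>F k in sequentially. min 1 \<bar>g (axis n i (u k))\<bar> \<le> 20 / 19 * expectation (?X k)"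
        using int_ge by (intro always_eventually allI) (simp add: field_simps)
      show "(\<lambda>k. 20 / 19 * expectation (?X k)) \<longlonglongrightarrow> 0"
        using tendsto_mult_left[OF int_lim, of "20 / 19"] by simp
    qed
    show ?thesis
    proof (rule LIMSEQ_I)
      fix \<delta> :: real assume "\<delta> > 0"
      \<comment> \<open>Below 1 the truncation is inactive, so a bound by
        \<open>min 1 \<delta>\<close> on the truncated value is a bound by \<delta> on the value
        itself.\<close>
      then have "min 1 \<delta> > 0" by simp
      from LIMSEQ_D[OF \<open>(\<lambda>k. min 1 \<bar>g (axis n i (u k))\<bar>) \<longlonglongrightarrow> 0\<close> this]
      show "\<exists>no. \<forall>k\<ge>no. norm (g (axis n i (u k)) - 0) < \<delta>"
        by (fastforce simp: min_def split: if_splits)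
    qed
  qed
  have g_axis: "g (axis n i t) = t / r * g (axis n i r)" if "\<bar>t\<bar> \<le> r" for i t
  proof (rule locally_additive_imp_linear[OF \<open>r > 0\<close> _ _ that])
    fix s t :: real assume "\<bar>s\<bar> \<le> r" "\<bar>t\<bar> \<le> r" "\<bar>s + t\<bar> \<le> r"
    then show "g (axis n i (s + t)) = g (axis n i s) + g (axis n i t)"
      using g_add[of "axis n i s" "axis n i t"] by (simp add: vadd_axis small_shift_axis r_def)
  qed (rule g_lim)
  \<comment> \<open>Coordinates are switched on one at a time. Every intermediate point has
    coordinates equal to those of \<open>p\<close> or to 0, so it is again a small shift and local
    additivity applies.\<close>
  have g_sum: "g (\<lambda>j\<in>{..<n}. if j < m then p j else 0) = (\<Sum>i<m. g (axis n i r) / r * p i)"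
    if p: "small_shift n p" and "m \<le> n" for m p
    using \<open>m \<le> n\<close>
  proof (induction m)
    case 0
    have eq: "(\<lambda>j\<in>{..<n}. if j < 0 then p j else 0) = axis n 0 0"
      by (auto simp: axis_def)
    show ?case
      unfolding eq using g_axis[of 0 0] \<open>r > 0\<close> by simp
  next
    case (Suc m)
    let ?p = "\<lambda>m. \<lambda>j\<in>{..<n}. if j < m then p j else 0"
    have small: "small_shift n (?p m)" for m
      using p by (auto simp: small_shift_def space_Rn)
    have pm: "\<bar>p m\<bar> \<le> r"
      using p Suc.prems by (simp add: small_shift_def r_def)
    have step: "vadd n (?p m) (axis n m (p m)) = ?p (Suc m)"
      by (auto simp: vadd_def axis_def less_Suc_eq)
    have "g (vadd n (?p m) (axis n m (p m))) = g (?p m) + g (axis n m (p m))"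
      using pm small[of "Suc m"] unfolding r_def
      by (intro g_add small small_shift_axis) (simp_all only: step)
    also have "g (?p m) = (\<Sum>i<m. g (axis n i r) / r * p i)"
      using Suc by (intro Suc.IH) simp
    also have "g (axis n m (p m)) = g (axis n m r) / r * p m"
      using g_axis[OF pm, of m] by simp
    finally show ?case
      unfolding step sum.lessThan_Suc .
  qed
  have g_eq: "g p = (\<Sum>i<n. g (axis n i r) / r * p i)" if p: "small_shift n p" for p
  proof -
    have "(\<lambda>j\<in>{..<n}. if j < n then p j else 0) = p"
      using p unfolding small_shift_def space_Rn PiE_iff extensional_def restrict_def by auto
    then show ?thesis
      using g_sum[OF p order_refl] by simp
  qed
  show ?thesis
    using g g_eq by (intro that[of "\<lambda>i. g (axis n i r) / r"]) auto
qed

section \<open>The tester\<close>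

text \<open>The factor \<open>k\<close> of the overview. The l1 norm dominates every coordinate and
  depends measurably on \<open>x\<close>; the summand 1 keeps the factor positive at the
  origin.\<close>

definition rescale :: "nat \<Rightarrow> point \<Rightarrow> real" where
  "rescale n x = 1 + 200 * real n * (\<Sum>i<n. \<bar>x i\<bar>)"

definition shrink :: "nat \<Rightarrow> point \<Rightarrow> point" where
  "shrink n x = vscale n (1 / rescale n x) x"

lemma rescale_pos: "rescale n x > 0"
  unfolding rescale_def by (intro add_pos_nonneg mult_nonneg_nonneg sum_nonneg) auto

lemma shrink_in_space [simp]: "shrink n x \<in> space (Rn n)"
  by (simp add: shrink_def)

lemma small_shift_shrink: "small_shift n (shrink n x)"
  unfolding small_shift_def
proof (intro conjI allI impI)
  fix i assume i: "i < n"
  have "\<bar>x i\<bar> \<le> (\<Sum>i<n. \<bar>x i\<bar>)"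
    using i by (intro member_le_sum) auto
  then have "200 * real n * \<bar>x i\<bar> \<le> rescale n x"
    unfolding rescale_def by (intro add_increasing mult_left_mono) auto
  then show "\<bar>shrink n x i\<bar> \<le> 1 / (200 * real n)"
    using i rescale_pos[of n x]
    by (simp add: shrink_def vscale_def abs_divide field_simps)
qed simp

lemma measurable_rescale [measurable]: "rescale n \<in> borel_measurable (Rn n)"
  unfolding rescale_def
  by (intro borel_measurable_add borel_measurable_times borel_measurable_sum borel_measurable_abs)
     (auto intro: measurable_Rn_component)

lemma measurable_shrink [measurable]: "shrink n \<in> Rn n \<rightarrow>\<^sub>M Rn n"
  unfolding shrink_def by measurable

text \<open>Both checks use the same \<open>z\<close>, and the answer \<open>fz\<close> is shared,
  so a round costs five queries. All samples of a round precede its queries, so its law is a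
  threefold bind over a single case distinction.\<close>

primrec tester :: "nat \<Rightarrow> nat \<Rightarrow> algo" where
  "tester n 0 = Verdict True"
| "tester n (Suc m) =
     Sample_Gauss (\<lambda>z. Sample_Gauss (\<lambda>w. Sample (\<lambda>x.
       Query z (\<lambda>fz. Query w (\<lambda>fw. Query (vadd n z w) (\<lambda>fzw.
       Query x (\<lambda>fx. Query (vadd n z (shrink n x)) (\<lambda>fzx.
         if fz + fw = fzw \<and> fx = rescale n x * (fzx - fz) then tester n m else Verdict False))))))))"

lemma queries_le_tester: "queries_le n (tester n m) (5 * m)"
  by (induction m) (simp_all add: numeral_eq_Suc)

definition sum_ok :: "nat \<Rightarrow> (point \<Rightarrow> real) \<Rightarrow> point \<Rightarrow> point \<Rightarrow> bool" where
  "sum_ok n f z w \<longleftrightarrow> f z + f w = f (vadd n z w)"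

definition value_ok :: "nat \<Rightarrow> (point \<Rightarrow> real) \<Rightarrow> point \<Rightarrow> point \<Rightarrow> bool" where
  "value_ok n f z x \<longleftrightarrow> f x = rescale n x * (f (vadd n z (shrink n x)) - f z)"

text \<open>The probability that one round passes, integrated in the order in which the tester draws
  its samples, to match the nested binds.\<close>

definition pass_prob :: "nat \<Rightarrow> (point \<Rightarrow> real) \<Rightarrow> point measure \<Rightarrow> ennreal" where
  "pass_prob n f D = (\<integral>\<^sup>+ z. \<integral>\<^sup>+ w.
     emeasure D {x \<in> space D. sum_ok n f z w \<and> value_ok n f z x} \<partial>gaussian n \<partial>gaussian n)"

lemma run_tester_Suc:
  "run n f D (tester n (Suc m)) =
     gaussian n \<bind> (\<lambda>z. gaussian n \<bind> (\<lambda>w. D \<bind> (\<lambda>x.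
       if sum_ok n f z w \<and> value_ok n f z x then run n f D (tester n m)
       else return (count_space UNIV) False)))"
  by (simp add: sum_ok_def value_ok_def if_distrib[of "run n f D"] cong: if_cong)

lemma bind_in_prob_algebra:
  assumes "M \<in> space (prob_algebra N)" "k \<in> N \<rightarrow>\<^sub>M prob_algebra R"
  shows "M \<bind> k \<in> space (prob_algebra R)"
  unfolding space_prob_algebra using prob_space_bind'[OF assms] sets_bind'[OF assms] by simp

section \<open>The output distribution of the tester\<close>

locale tester_input =
  fixes n :: nat and f :: "point \<Rightarrow> real" and D :: "point measure"
  assumes continuous: "continuous_Rn n f" and distribution: "distribution_on n D"
begin

lemma f_measurable [measurable]: "f \<in> borel_measurable (Rn n)"
  by (rule continuous_Rn_measurable[OF continuous])

lemma sets_D [measurable_cong, simp]: "sets D = sets (Rn n)"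
  using distribution by (simp add: distribution_on_def)

lemma space_D [simp]: "space D = space (Rn n)"
  by (rule sets_eq_imp_space_eq) simp

sublocale D: prob_space D
  using distribution by (simp add: distribution_on_def)

sublocale G: prob_space "gaussian n"
  by (rule prob_space_gaussian)

lemma sum_ok_measurable [measurable]:
  "Measurable.pred (gaussian n \<Otimes>\<^sub>M gaussian n) (\<lambda>(z, w). sum_ok n f z w)"
  unfolding sum_ok_def by measurable

lemma value_ok_measurable [measurable]:
  "Measurable.pred (gaussian n \<Otimes>\<^sub>M D) (\<lambda>(z, x). value_ok n f z x)"
  unfolding value_ok_def by measurable

lemma round_ok_measurable [measurable]:
  "Measurable.pred ((gaussian n \<Otimes>\<^sub>M gaussian n) \<Otimes>\<^sub>M D)
     (\<lambda>(p, x). sum_ok n f (fst p) (snd p) \<and> value_ok n f (fst p) x)"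
  unfolding sum_ok_def value_ok_def by measurable

context
  fixes R :: "bool measure"
  assumes R: "R \<in> space (prob_algebra (count_space UNIV))"
begin

text \<open>After a passed round the rest of the run has the same law \<open>R\<close> whatever was
  sampled. The kernel takes only two values, and its measurability reduces to that of the predicate
  deciding between them.\<close>

abbreviation "round_kernel z w x \<equiv>
  (if sum_ok n f z w \<and> value_ok n f z x then R else return (count_space UNIV) False)"

lemma kernel_measurable:
  "(\<lambda>(p, x). round_kernel (fst p) (snd p) x)
     \<in> (gaussian n \<Otimes>\<^sub>M gaussian n) \<Otimes>\<^sub>M D \<rightarrow>\<^sub>M prob_algebra (count_space UNIV)"
  unfolding split_beta'
  by (intro measurable_If measurable_const R predE[OF round_ok_measurable[unfolded split_beta']])
     (simp add: space_prob_algebra prob_space_return)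

lemma bind_D_measurable:
  "(\<lambda>(z, w). D \<bind> round_kernel z w) \<in> gaussian n \<Otimes>\<^sub>M gaussian n \<rightarrow>\<^sub>M prob_algebra (count_space UNIV)"
  unfolding split_beta'
  by (rule measurable_bind_prob_space2[OF _ kernel_measurable])
     (simp add: space_prob_algebra D.prob_space_axioms)

lemma bind_gaussian_measurable:
  "(\<lambda>z. gaussian n \<bind> (\<lambda>w. D \<bind> round_kernel z w)) \<in> gaussian n \<rightarrow>\<^sub>M prob_algebra (count_space UNIV)"
  by (rule measurable_bind_prob_space2[OF _ bind_D_measurable])
     (simp add: space_prob_algebra G.prob_space_axioms)

lemma bind_D_section:
  "z \<in> space (Rn n) \<Longrightarrow> (\<lambda>w. D \<bind> round_kernel z w) \<in> gaussian n \<rightarrow>\<^sub>M prob_algebra (count_space UNIV)"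
  using measurable_Pair2[OF bind_D_measurable, of z] by simp

lemma kernel_section:
  "z \<in> space (Rn n) \<Longrightarrow> w \<in> space (Rn n) \<Longrightarrow>
     round_kernel z w \<in> D \<rightarrow>\<^sub>M prob_algebra (count_space UNIV)"
  using measurable_Pair2[OF kernel_measurable, of "(z, w)"] by (simp add: space_pair_measure)

lemma round_in_prob_algebra:
  "gaussian n \<bind> (\<lambda>z. gaussian n \<bind> (\<lambda>w. D \<bind> round_kernel z w)) \<in> space (prob_algebra (count_space UNIV))"
  by (rule bind_in_prob_algebra[OF _ bind_gaussian_measurable])
     (simp add: space_prob_algebra G.prob_space_axioms)

text \<open>The kernel gives \<open>True\<close> the mass \<open>emeasure R {True}\<close> when both
  checks pass and 0 otherwise; this constant is pulled out of the three integrals from the inside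
  outwards.\<close>

lemma emeasure_round:
  "emeasure (gaussian n \<bind> (\<lambda>z. gaussian n \<bind> (\<lambda>w. D \<bind> round_kernel z w))) {True} =
     pass_prob n f D * emeasure R {True}"
proof -
  let ?ok = "\<lambda>z w. {x \<in> space D. sum_ok n f z w \<and> value_ok n f z x}"
  have ne: "space (gaussian n) \<noteq> {}" "space D \<noteq> {}"
    using G.not_empty D.not_empty by auto
  have ok_meas: "(\<lambda>(z, w). emeasure D (?ok z w)) \<in> borel_measurable (gaussian n \<Otimes>\<^sub>M gaussian n)"
  proof -
    interpret GG: pair_prob_space "gaussian n" "gaussian n" ..
    show ?thesis
      using section_measures(1)[OF GG.prob_space_axioms D.prob_space_axioms round_ok_measurable]
      by (simp add: split_beta')
  qed
  have ok_sets: "?ok z w \<in> sets D" if "z \<in> space (Rn n)" for z w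
  proof (cases "sum_ok n f z w")
    case True
    then show ?thesis
      using measurable_Pair2[OF value_ok_measurable, of z] that by simp
  qed simp
  have inner: "emeasure (D \<bind> round_kernel z w) {True} = emeasure D (?ok z w) * emeasure R {True}"
    if zw: "z \<in> space (Rn n)" "w \<in> space (Rn n)" for z w
  proof -
    have "emeasure (D \<bind> round_kernel z w) {True} = (\<integral>\<^sup>+ x. emeasure (round_kernel z w x) {True} \<partial>D)"
      by (rule emeasure_bind[OF ne(2) measurable_prob_algebraD[OF kernel_section[OF zw]]]) simp
    also have "\<dots> = (\<integral>\<^sup>+ x. indicator (?ok z w) x * emeasure R {True} \<partial>D)"
      by (intro nn_integral_cong) (auto split: split_indicator)
    also have "\<dots> = emeasure D (?ok z w) * emeasure R {True}"
      using ok_sets[OF zw(1)] by (subst nn_integral_multc) simp_all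
    finally show ?thesis .
  qed
  have middle: "emeasure (gaussian n \<bind> (\<lambda>w. D \<bind> round_kernel z w)) {True} =
      (\<integral>\<^sup>+ w. emeasure D (?ok z w) \<partial>gaussian n) * emeasure R {True}" if z: "z \<in> space (Rn n)" for z
  proof -
    have "emeasure (gaussian n \<bind> (\<lambda>w. D \<bind> round_kernel z w)) {True} =
        (\<integral>\<^sup>+ w. emeasure (D \<bind> round_kernel z w) {True} \<partial>gaussian n)"
      by (rule emeasure_bind[OF ne(1) measurable_prob_algebraD[OF bind_D_section[OF z]]]) simp
    also have "\<dots> = (\<integral>\<^sup>+ w. emeasure D (?ok z w) * emeasure R {True} \<partial>gaussian n)"
      by (intro nn_integral_cong inner z) simp
    also have "\<dots> = (\<integral>\<^sup>+ w. emeasure D (?ok z w) \<partial>gaussian n) * emeasure R {True}"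
      using measurable_Pair2[OF ok_meas, of z] z by (intro nn_integral_multc) simp
    finally show ?thesis .
  qed
  have "emeasure (gaussian n \<bind> (\<lambda>z. gaussian n \<bind> (\<lambda>w. D \<bind> round_kernel z w))) {True} =
      (\<integral>\<^sup>+ z. emeasure (gaussian n \<bind> (\<lambda>w. D \<bind> round_kernel z w)) {True} \<partial>gaussian n)"
    by (rule emeasure_bind[OF ne(1) measurable_prob_algebraD[OF bind_gaussian_measurable]]) simp
  also have "\<dots> = (\<integral>\<^sup>+ z. (\<integral>\<^sup>+ w. emeasure D (?ok z w) \<partial>gaussian n) * emeasure R {True} \<partial>gaussian n)"
    by (intro nn_integral_cong middle) simp
  also have "\<dots> = pass_prob n f D * emeasure R {True}"
    unfolding pass_prob_def
    by (intro nn_integral_multc G.borel_measurable_nn_integral ok_meas)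
  finally show ?thesis .
qed

end

lemma run_tester_in_prob_algebra: "run n f D (tester n m) \<in> space (prob_algebra (count_space UNIV))"
proof (induction m)
  case 0
  show ?case by (simp add: space_prob_algebra prob_space_return)
next
  case (Suc m)
  show ?case
    unfolding run_tester_Suc by (rule round_in_prob_algebra[OF Suc])
qed

text \<open>Every round draws fresh samples; the independence of the rounds shows up as the
  power.\<close>

lemma emeasure_run_tester: "emeasure (run n f D (tester n m)) {True} = pass_prob n f D ^ m"
proof (induction m)
  case (Suc m)
  show ?case
    unfolding run_tester_Suc emeasure_round[OF run_tester_in_prob_algebra] Suc by simp
qed simp

text \<open>Each of the three sampling nodes of a round asks for a measurable kernel. These are the
  three facts on \<open>round_kernel\<close> with the law of the remaining rounds for
  \<open>R\<close>.\<close>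

lemma well_posed_tester: "well_posed n f D (tester n m)"
proof (induction m)
  case (Suc m)
  note R = run_tester_in_prob_algebra[of m]
  note [simp] = if_distrib[of "run n f D"] if_distrib[of "well_posed n f D"]
  show ?case
    using bind_gaussian_measurable[OF R] bind_D_section[OF R] kernel_section[OF R] Suc
    by (simp add: sum_ok_def value_ok_def cong: if_cong)
qed simp

end

section \<open>Acceptance of linear functions and rejection of far functions\<close>

lemma linear_Rn_sum: "linear_Rn n (\<lambda>x. \<Sum>i<n. a i * x i)"
  by (simp add: linear_Rn_def additive_Rn_def homogeneous_Rn_def vadd_def vscale_def
      distrib_left sum.distrib sum_distrib_left mult.left_commute)

context tester_input
begin

lemma pass_prob_linear:
  assumes lin: "linear_Rn n f"
  shows "pass_prob n f D = 1"
proof -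
  have "value_ok n f z x" if "z \<in> space (Rn n)" "x \<in> space (Rn n)" for z x
  proof -
    have "f (vadd n z (shrink n x)) - f z = f (shrink n x)"
      using lin that by (simp add: linear_Rn_def additive_Rn_def)
    also have "\<dots> = 1 / rescale n x * f x"
      using lin that by (simp add: linear_Rn_def homogeneous_Rn_def shrink_def)
    finally show ?thesis
      using rescale_pos[of n x] by (simp add: value_ok_def)
  qed
  moreover have "sum_ok n f z w" if "z \<in> space (Rn n)" "w \<in> space (Rn n)" for z w
    using lin that by (simp add: sum_ok_def linear_Rn_def additive_Rn_def)
  ultimately have "pass_prob n f D = (\<integral>\<^sup>+ z. \<integral>\<^sup>+ w. emeasure D (space D) \<partial>gaussian n \<partial>gaussian n)"
    unfolding pass_prob_def
    by (intro nn_integral_cong arg_cong[where f = "emeasure D"]) auto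
  then show ?thesis
    using G.emeasure_space_1 by (simp add: D.emeasure_space_1[simplified])
qed

text \<open>A passed round has passed the first check. The sum form avoids subtraction in the
  extended reals.\<close>

lemma pass_prob_plus_defect: "pass_prob n f D + addition_defect n f \<le> 1"
proof -
  let ?good = "\<lambda>z. {w \<in> space (gaussian n). sum_ok n f z w}"
  let ?bad = "\<lambda>z. {w \<in> space (gaussian n). \<not> sum_ok n f z w}"
  have bad_pred: "Measurable.pred (gaussian n \<Otimes>\<^sub>M gaussian n) (\<lambda>(z, w). \<not> sum_ok n f z w)"
    using sum_ok_measurable by (simp add: split_beta')
  have good_sets: "?good z \<in> G.events" if "z \<in> space (Rn n)" for z
    using measurable_Pair2[OF sum_ok_measurable, of z] that by simp
  have bad_sets: "?bad z \<in> G.events" if "z \<in> space (Rn n)" for z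
    using measurable_Pair2[OF bad_pred, of z] that by simp
  have "(\<integral>\<^sup>+ w. emeasure D {x \<in> space D. sum_ok n f z w \<and> value_ok n f z x} \<partial>gaussian n) \<le>
      emeasure (gaussian n) (?good z)" if z: "z \<in> space (Rn n)" for z
  proof -
    have "(\<integral>\<^sup>+ w. emeasure D {x \<in> space D. sum_ok n f z w \<and> value_ok n f z x} \<partial>gaussian n) \<le>
        (\<integral>\<^sup>+ w. indicator (?good z) w \<partial>gaussian n)"
      by (intro nn_integral_mono) (auto split: split_indicator intro: D.emeasure_le_1)
    then show ?thesis
      using good_sets[OF z] by (simp only: nn_integral_indicator)
  qed
  then have pass_le: "pass_prob n f D \<le> (\<integral>\<^sup>+ z. emeasure (gaussian n) (?good z) \<partial>gaussian n)"
    unfolding pass_prob_def by (intro nn_integral_mono) simp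
  \<comment> \<open>\<open>pass_prob\<close> has \<open>w\<close> inside and the defect has
    \<open>z\<close> inside; commutativity of addition exchanges their roles.\<close>
  have defect_eq: "addition_defect n f = (\<integral>\<^sup>+ z. emeasure (gaussian n) (?bad z) \<partial>gaussian n)"
    unfolding addition_defect_def sum_ok_def space_gaussian
    by (subst vadd_commute) (simp only: add.commute)
  have "(\<integral>\<^sup>+ z. emeasure (gaussian n) (?good z) \<partial>gaussian n) + addition_defect n f =
      (\<integral>\<^sup>+ z. emeasure (gaussian n) (?good z) + emeasure (gaussian n) (?bad z) \<partial>gaussian n)"
    unfolding defect_eq
    by (intro nn_integral_add[symmetric]
        section_measures(1)[OF prob_space_gaussian prob_space_gaussian sum_ok_measurable]
        section_measures(1)[OF prob_space_gaussian prob_space_gaussian bad_pred])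
  also have "\<dots> = (\<integral>\<^sup>+ z. 1 \<partial>gaussian n)"
  proof (intro nn_integral_cong)
    fix z assume "z \<in> space (gaussian n)"
    then have z: "z \<in> space (Rn n)" by simp
    have partition: "?good z \<union> ?bad z = space (gaussian n)" "?good z \<inter> ?bad z = {}"
      by auto
    show "emeasure (gaussian n) (?good z) + emeasure (gaussian n) (?bad z) = 1"
      unfolding plus_emeasure[OF good_sets[OF z] bad_sets[OF z] partition(2)] partition(1)
      by (rule G.emeasure_space_1)
  qed
  also have "\<dots> = 1"
    using G.emeasure_space_1 by simp
  finally show ?thesis
    using add_right_mono[OF pass_le, of "addition_defect n f"] by (simp only:)
qed

text \<open>Only the second check is used. For fixed \<open>x\<close> with
  \<open>f x \<noteq> L x\<close>, a \<open>z\<close> at which the difference for \<open>x/k\<close>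
  has its majority value makes the check compare \<open>f x\<close> with \<open>L x\<close>, and it
  fails. Such \<open>x\<close> have probability above \<epsilon> because \<open>L\<close> is one of
  the functions from which \<open>f\<close> is far.\<close>

lemma pass_prob_far_small_defect:
  assumes "n \<ge> 1" and defect: "addition_defect n f \<le> ennreal (1 / 100)"
    and far: "far n D (linear_Rn n) \<epsilon> f"
  shows "pass_prob n f D \<le> ennreal (1 - 19 / 20 * \<epsilon>)"
proof -
  obtain a where a: "\<And>p. small_shift n p \<Longrightarrow>
      G.prob {z \<in> space (Rn n). f (vadd n z p) - f z \<noteq> (\<Sum>i<n. a i * p i)} \<le> 1 / 20"
    using gaussian_differences_linear[OF \<open>n \<ge> 1\<close> continuous defect] by blast
  define L where "L x = (\<Sum>i<n. a i * x i)" for x :: point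
  have L_meas: "L \<in> borel_measurable (Rn n)"
    unfolding L_def
    by (intro borel_measurable_sum borel_measurable_times) (auto intro: measurable_Rn_component)
  have lin: "linear_Rn n L"
    using linear_Rn_sum[of n a] by (simp add: L_def[abs_def])
  define W where "W = {x \<in> space D. f x \<noteq> L x}"
  have W: "W \<in> D.events"
    unfolding W_def sets_D space_D by (intro borel_measurable_neq f_measurable L_meas)
  have W_gt: "D.prob W > \<epsilon>"
    using far L_meas lin by (simp add: far_def W_def)
  have value_sets: "{z \<in> space (gaussian n). value_ok n f z x} \<in> G.events" if "x \<in> space (Rn n)" for x
    using measurable_Pair1[OF value_ok_measurable, of x] that by simp
  have value_le: "emeasure (gaussian n) {z \<in> space (gaussian n). value_ok n f z x} \<le>
      ennreal (1 - 19 / 20 * indicator W x)" if x: "x \<in> space (Rn n)" for x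
  proof (cases "x \<in> W")
    case False
    then show ?thesis by (simp add: G.emeasure_le_1)
  next
    case True
    have "L (shrink n x) = 1 / rescale n x * L x"
      using lin x by (simp add: linear_Rn_def homogeneous_Rn_def shrink_def)
    then have L_rescale: "L x = rescale n x * L (shrink n x)"
      using rescale_pos[of n x] by simp
    let ?D = "{z \<in> space (Rn n). f (vadd n z (shrink n x)) - f z \<noteq> L (shrink n x)}"
    have "?D \<in> G.events"
    proof -
      have "(\<lambda>z. f (vadd n z (shrink n x))) \<in> borel_measurable (Rn n)"
        by (intro measurable_compose[OF _ f_measurable] measurable_vadd) auto
      then have "?D \<in> sets (Rn n)"
        by (intro borel_measurable_neq borel_measurable_diff f_measurable) auto
      then show ?thesis by simp
    qed
    moreover have "{z \<in> space (gaussian n). value_ok n f z x} \<subseteq> ?D"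
      using True L_rescale by (auto simp: value_ok_def W_def)
    ultimately have "G.prob {z \<in> space (gaussian n). value_ok n f z x} \<le> G.prob ?D"
      by (intro G.finite_measure_mono)
    also have "\<dots> \<le> 1 / 20"
      using a[OF small_shift_shrink[of n x]] by (simp add: L_def)
    finally show ?thesis
      using True by (simp add: G.emeasure_eq_measure)
  qed
  have "pass_prob n f D \<le>
      (\<integral>\<^sup>+ z. \<integral>\<^sup>+ w. emeasure D {x \<in> space D. value_ok n f z x} \<partial>gaussian n \<partial>gaussian n)"
    unfolding pass_prob_def
  proof (intro nn_integral_mono emeasure_mono)
    fix z assume "z \<in> space (gaussian n)"
    then show "{x \<in> space D. value_ok n f z x} \<in> D.events"
      using measurable_Pair2[OF value_ok_measurable, of z] by simp
  qed auto
  also have "\<dots> = (\<integral>\<^sup>+ z. emeasure D {x \<in> space D. value_ok n f z x} \<partial>gaussian n)"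
    using G.emeasure_space_1 by simp
  \<comment> \<open>The tester draws \<open>z\<close> before \<open>x\<close>, whereas
    \<open>value_le\<close> is an estimate for fixed \<open>x\<close>.\<close>
  also have "\<dots> = (\<integral>\<^sup>+ x. emeasure (gaussian n) {z \<in> space (gaussian n). value_ok n f z x} \<partial>D)"
    by (rule section_measures(3)[OF prob_space_gaussian D.prob_space_axioms value_ok_measurable, symmetric])
  also have "\<dots> \<le> (\<integral>\<^sup>+ x. ennreal (1 - 19 / 20 * indicator W x) \<partial>D)"
    by (intro nn_integral_mono value_le) simp
  also have "\<dots> = ennreal (\<integral> x. 1 - 19 / 20 * indicator W x \<partial>D)"
  proof (rule nn_integral_eq_integral)
    show "integrable D (\<lambda>x. 1 - 19 / 20 * indicator W x :: real)"
      using W by (intro Bochner_Integration.integrable_diff integrable_mult_right integrable_real_indicator)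
        (auto simp: D.emeasure_eq_measure)
  qed (auto split: split_indicator)
  also have "(\<integral> x. 1 - 19 / 20 * indicator W x \<partial>D) = 1 - 19 / 20 * D.prob W"
    using W D.prob_space
    by (subst Bochner_Integration.integral_diff)
       (auto intro!: integrable_mult_right integrable_real_indicator simp: D.emeasure_eq_measure)
  also have "ennreal \<dots> \<le> ennreal (1 - 19 / 20 * \<epsilon>)"
    using W_gt by (intro ennreal_leI) simp
  finally show ?thesis .
qed

lemma pass_prob_far:
  assumes "n \<ge> 1" "\<epsilon> > 0" and far: "far n D (linear_Rn n) \<epsilon> f"
  shows "\<epsilon> < 1" "pass_prob n f D \<le> ennreal (1 - \<epsilon> / 100)"
proof -
  \<comment> \<open>The zero function is linear, so being \<epsilon>-far forces \<epsilon> < 1. This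
    makes a rejection rate of 1/100 at least \<epsilon>/100.\<close>
  have "D.prob {x \<in> space D. f x \<noteq> (\<Sum>i<n. 0 * x i)} > \<epsilon>"
    using far linear_Rn_sum[of n "\<lambda>_. 0"] by (simp add: far_def)
  then show "\<epsilon> < 1"
    using D.prob_le_1 by (rule less_le_trans)
  show "pass_prob n f D \<le> ennreal (1 - \<epsilon> / 100)"
  proof (cases "addition_defect n f \<le> ennreal (1 / 100)")
    case True
    have "pass_prob n f D \<le> ennreal (1 - 19 / 20 * \<epsilon>)"
      by (rule pass_prob_far_small_defect[OF \<open>n \<ge> 1\<close> True far])
    also have "\<dots> \<le> ennreal (1 - \<epsilon> / 100)"
      using \<open>\<epsilon> > 0\<close> by (intro ennreal_leI) simp
    finally show ?thesis .
  next
    case False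
    then have "pass_prob n f D + ennreal (1 / 100) \<le> 1"
      using pass_prob_plus_defect by (meson add_left_mono le_cases order_trans)
    then have "pass_prob n f D \<le> 1 - ennreal (1 / 100)"
      by (simp add: ennreal_le_minus_iff)
    also have "\<dots> = ennreal (1 - 1 / 100)"
      by (subst ennreal_minus[symmetric]) simp_all
    also have "\<dots> \<le> ennreal (1 - \<epsilon> / 100)"
      using \<open>\<epsilon> < 1\<close> by (intro ennreal_leI) simp
    finally show ?thesis .
  qed
qed

lemma tester_accepts_linear:
  "linear_Rn n f \<Longrightarrow> measure (run n f D (tester n m)) {True} = 1"
  using emeasure_run_tester[of m] by (simp add: pass_prob_linear measure_def)

lemma tester_rejects_far:
  assumes "n \<ge> 1" "\<epsilon> > 0" and far: "far n D (linear_Rn n) \<epsilon> f" and m: "200 / \<epsilon> \<le> real m"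
  shows "measure (run n f D (tester n m)) {False} \<ge> 2 / 3"
proof -
  let ?R = "run n f D (tester n m)"
  have sets_R: "sets ?R = UNIV" and prob_R: "prob_space ?R"
    using run_tester_in_prob_algebra[of m] by (simp_all add: space_prob_algebra)
  interpret R: prob_space ?R by (rule prob_R)
  have space_R: "space ?R = UNIV"
    using sets_eq_imp_space_eq[of ?R "count_space UNIV"] sets_R by simp
  note \<epsilon> = pass_prob_far[OF assms(1-3)]
  have "(1 - \<epsilon> / 100) ^ m \<le> exp (- (\<epsilon> / 100)) ^ m"
    using exp_ge_add_one_self[of "- (\<epsilon> / 100)"] \<epsilon>(1) \<open>\<epsilon> > 0\<close> by (intro power_mono) auto
  also have "\<dots> = exp (- (real m * \<epsilon> / 100))"
    by (simp flip: exp_of_nat_mult)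
  also have "\<dots> \<le> exp (- 2)"
    using m \<open>\<epsilon> > 0\<close> by (simp add: field_simps)
  \<comment> \<open>The 200 in the number of rounds makes the exponent -2, and exp 2 \<ge> 1 +
    2.\<close>
  also have "\<dots> \<le> 1 / 3"
    using exp_ge_add_one_self[of 2] by (simp add: exp_minus field_simps)
  finally have pow: "(1 - \<epsilon> / 100) ^ m \<le> 1 / 3" .
  have "ennreal (R.prob {True}) = pass_prob n f D ^ m"
    by (simp add: emeasure_run_tester flip: R.emeasure_eq_measure)
  also have "\<dots> \<le> ennreal (1 - \<epsilon> / 100) ^ m"
    by (intro power_mono \<epsilon>) simp
  also have "\<dots> = ennreal ((1 - \<epsilon> / 100) ^ m)"
    using \<epsilon>(1) by (intro ennreal_power) simp
  also have "\<dots> \<le> ennreal (1 / 3)"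
    using pow by (intro ennreal_leI)
  finally have "R.prob {True} \<le> 1 / 3"
    by (subst (asm) ennreal_le_iff) auto
  moreover have "R.prob {False} = 1 - R.prob {True}"
  proof -
    have "{False} = space ?R - {True}"
      unfolding space_R by auto
    then show ?thesis
      using R.prob_compl[of "{True}"] sets_R by simp
  qed
  ultimately show ?thesis by simp
qed

end

definition rounds :: "real \<Rightarrow> nat" where
  "rounds \<epsilon> = nat \<lceil>200 / \<epsilon>\<rceil>"

text \<open>For \<epsilon> < exp (- 1) the logarithm is at least 1, so a bound by a multiple of
  1/\<epsilon> is enough. Rounding up adds at most 1 < 1/\<epsilon> to 200/\<epsilon>, and 1005 = 5
  * 201.\<close>

lemma rounds_bigo: "(\<lambda>\<epsilon>. real (5 * rounds \<epsilon>)) \<in> O[at_right 0](\<lambda>\<epsilon>. 1 / \<epsilon> * ln (1 / \<epsilon>))"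
proof (rule landau_o.bigI)
  show "\<forall>\<^sub>F \<epsilon> in at_right 0. norm (real (5 * rounds \<epsilon>)) \<le> 1005 * norm (1 / \<epsilon> * ln (1 / \<epsilon>))"
    unfolding eventually_at_right_field
  proof (intro exI[of _ "exp (- 1)"] conjI allI impI)
    fix \<epsilon> :: real assume "0 < \<epsilon>" "\<epsilon> < exp (- 1)"
    then have "ln \<epsilon> < - 1"
      by (metis ln_exp ln_less_cancel_iff exp_gt_zero)
    then have ln: "1 \<le> ln (1 / \<epsilon>)"
      using \<open>0 < \<epsilon>\<close> by (simp add: ln_div)
    have "\<epsilon> < 1"
      using \<open>\<epsilon> < exp (- 1)\<close> by (rule less_le_trans) simp
    have "real (rounds \<epsilon>) \<le> 200 / \<epsilon> + 1"
      using \<open>0 < \<epsilon>\<close> unfolding rounds_def by simp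
    also have "\<dots> \<le> 201 * (1 / \<epsilon>)"
      using \<open>0 < \<epsilon>\<close> \<open>\<epsilon> < 1\<close> by (simp add: field_simps)
    finally have "real (5 * rounds \<epsilon>) \<le> 1005 * (1 / \<epsilon> * 1)"
      by simp
    also have "\<dots> \<le> 1005 * (1 / \<epsilon> * ln (1 / \<epsilon>))"
      using ln \<open>0 < \<epsilon>\<close> by (intro mult_left_mono) auto
    also have "\<dots> \<le> 1005 * norm (1 / \<epsilon> * ln (1 / \<epsilon>))"
      unfolding real_norm_def by (intro mult_left_mono abs_ge_self) simp
    finally show "norm (real (5 * rounds \<epsilon>)) \<le> 1005 * norm (1 / \<epsilon> * ln (1 / \<epsilon>))"
      by simp
  qed simp
qed simp

theorem theorem1p2:
  "\<exists>(q :: real \<Rightarrow> nat) (T :: nat \<Rightarrow> real \<Rightarrow> algo).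
     (\<lambda>\<epsilon>. real (q \<epsilon>)) \<in> O[at_right 0](\<lambda>\<epsilon>. 1 / \<epsilon> * ln (1 / \<epsilon>)) \<and>
     (\<forall>n\<ge>1.
        distribution_free_tester n (continuous_Rn n) (linear_Rn n) (T n) \<and>
        one_sided n (continuous_Rn n) (linear_Rn n) (T n) \<and>
        (\<forall>\<epsilon>>0. queries_le n (T n \<epsilon>) (q \<epsilon>)))"
proof (intro exI conjI allI impI)
  show "(\<lambda>\<epsilon>. real (5 * rounds \<epsilon>)) \<in> O[at_right 0](\<lambda>\<epsilon>. 1 / \<epsilon> * ln (1 / \<epsilon>))"
    by (rule rounds_bigo)
  fix n :: nat assume "1 \<le> n"
  show "one_sided n (continuous_Rn n) (linear_Rn n) (\<lambda>\<epsilon>. tester n (rounds \<epsilon>))"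
    unfolding one_sided_def
    by (intro allI impI) (rule tester_input.tester_accepts_linear, rule tester_input.intro)
  show "distribution_free_tester n (continuous_Rn n) (linear_Rn n) (\<lambda>\<epsilon>. tester n (rounds \<epsilon>))"
    unfolding distribution_free_tester_def
  proof (intro allI impI conjI)
    fix \<epsilon> :: real and f D
    assume "\<epsilon> > 0" "continuous_Rn n f" "distribution_on n D"
    then interpret tester_input n f D
      by unfold_locales
    show "well_posed n f D (tester n (rounds \<epsilon>))"
      by (rule well_posed_tester)
    show "measure (run n f D (tester n (rounds \<epsilon>))) {True} \<ge> 2 / 3" if "linear_Rn n f"
      using tester_accepts_linear[OF that] by simp
    show "measure (run n f D (tester n (rounds \<epsilon>))) {False} \<ge> 2 / 3" if "far n D (linear_Rn n) \<epsilon> f"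
      using \<open>1 \<le> n\<close> \<open>\<epsilon> > 0\<close> that
    proof (rule tester_rejects_far)
      show "200 / \<epsilon> \<le> real (rounds \<epsilon>)"
        unfolding rounds_def by linarith
    qed
  qed
  show "queries_le n (tester n (rounds \<epsilon>)) (5 * rounds \<epsilon>)" for \<epsilon> :: real
    by (rule queries_le_tester)
qed

end
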